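(* Let $\alpha,\beta,\gamma>-1$, $\alpha\ne\beta$ and $|\alpha-\beta|<1$, and let $Q_{\vec\nu}$ be the type I Jacobi–Piñeiro linear forms and $b,c,d$ the entries of the step-line Jacobi matrix, as in the context. Then the semi-infinite matrix $P_I=(P_{I,k,l})_{k,l\in\mathbb N_0}$, with $P_{I,k,l}=0$ unless $k-1\le l\le k+2$ and, for $n=0,1,\dots$, $$P_{I,2n,2n+2}=\frac{Q_{(n+2,n+1)}(1)}{Q_{(n+1,n)}(1)}d_{n+1,n+1},\qquad P_{I,2n+1,2n+3}=\frac{Q_{(n+2,n+2)}(1)}{Q_{(n+1,n+1)}(1)}d_{n+2,n+1},$$ $$P_{I,2n,2n+1}=\frac{Q_{(n+1,n+1)}(1)}{Q_{(n+1,n)}(1)}c_{n+1,n},\qquad P_{I,2n+1,2n+2}=\frac{Q_{(n+2,n+1)}(1)}{Q_{(n+1,n+1)}(1)}c_{n+1,n+1},$$ $$P_{I,2n,2n}=b_{n,n},\qquad P_{I,2n+1,2n+1}=b_{n+1,n},$$ $$P_{I,2n+2,2n+1}=\frac{Q_{(n+1,n+1)}(1)}{Q_{(n+2,n+1)}(1)},\qquad P_{I,2n+1,2n}=\frac{Q_{(n+1,n)}(1)}{Q_{(n+1,n+1)}(1)},$$ is a multiple stochastic matrix of type I.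
   Context: The type I Jacobi–Piñeiro linear form with multi-index $\vec\nu=(\nu_1,\nu_2)$, $|\vec\nu|=\nu_1+\nu_2\ge1$, is $Q_{\vec\nu}(x)=A_{\vec\nu,1}(x)x^\alpha+A_{\vec\nu,2}(x)x^\beta$, where the polynomials $A_{\vec\nu,a}$ with $\deg A_{\vec\nu,a}\le\nu_a-1$ (zero if $\nu_a=0$) are determined by $\int_0^1Q_{\vec\nu}(x)(1-x)^\gamma x^j\,dx=0$ for $0\le j\le|\vec\nu|-2$ and $\int_0^1Q_{\vec\nu}(x)(1-x)^\gamma x^{|\vec\nu|-1}\,dx=1$. The monic Jacobi–Piñeiro multiple orthogonal polynomials of type II $B_{(n,m)}$ are the monic polynomials of degree $n+m$ with $$\int_0^1B_{(n,m)}(x)x^{\alpha+j}(1-x)^\gamma\,dx=0,\ 0\le j\le n-1,\qquad\int_0^1B_{(n,m)}(x)x^{\beta+j}(1-x)^\gamma\,dx=0,\ 0\le j\le m-1.$$ On the step-line put $B^{(2n)}=B_{(n,n)}$ and $B^{(2n+1)}=B_{(n+1,n)}$. The Jacobi matrix $J$ is defined by $xB^{(k)}(x)=\sum_lJ_{k,l}B^{(l)}(x)$; $J_{k,k+1}=1$ and $J_{k,l}=0$ unless $k-2\le l\le k+1$. Its remaining entries are denoted $b_{n,n}=J_{2n,2n}$, $b_{n+1,n}=J_{2n+1,2n+1}$, $c_{n+1,n}=J_{2n+1,2n}$, $c_{n+1,n+1}=J_{2n+2,2n+1}$, $d_{n+1,n+1}=J_{2n+2,2n}$, $d_{n+2,n+1}=J_{2n+3,2n+1}$.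 A multiple stochastic matrix of type I (here with two superdiagonals) is a semi-infinite matrix with nonnegative entries, each row summing to $1$, and $P_{k,l}=0$ unless $k-1\le l\le k+2$. *)

theory Defs
  imports "HOL-Analysis.Analysis" "HOL-Computational_Algebra.Polynomial"
begin

text \<open>All integrands below are absolutely integrable on the unit interval when
  \<open>\<alpha>, \<beta>, \<gamma> > -1\<close>, so the gauge integral used here is the Lebesgue integral.\<close>

definition linear_form :: "real \<Rightarrow> real \<Rightarrow> real poly \<times> real poly \<Rightarrow> real \<Rightarrow> real" where
  "linear_form \<alpha> \<beta> A x = poly (fst A) x * x powr \<alpha> + poly (snd A) x * x powr \<beta>"

text \<open>The range \<open>0 \<le> j \<le> n + m - 2\<close> is written \<open>j + 2 \<le> n + m\<close> to avoid truncated subtraction.\<close>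

definition is_typeI :: "real \<Rightarrow> real \<Rightarrow> real \<Rightarrow> nat \<Rightarrow> nat \<Rightarrow> real poly \<times> real poly \<Rightarrow> bool" where
  "is_typeI \<alpha> \<beta> \<gamma> n m A \<longleftrightarrow>
     degree (fst A) \<le> n - 1 \<and> (n = 0 \<longrightarrow> fst A = 0) \<and>
     degree (snd A) \<le> m - 1 \<and> (m = 0 \<longrightarrow> snd A = 0) \<and>
     (\<forall>j. j + 2 \<le> n + m \<longrightarrow>
        integral {0..1} (\<lambda>x. linear_form \<alpha> \<beta> A x * (1 - x) powr \<gamma> * x ^ j) = 0) \<and>
     integral {0..1} (\<lambda>x. linear_form \<alpha> \<beta> A x * (1 - x) powr \<gamma> * x ^ (n + m - 1)) = 1"

text \<open>Meaningful for \<open>n + m \<ge> 1\<close> only.\<close>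

definition Q_form :: "real \<Rightarrow> real \<Rightarrow> real \<Rightarrow> nat \<Rightarrow> nat \<Rightarrow> real \<Rightarrow> real" where
  "Q_form \<alpha> \<beta> \<gamma> n m = linear_form \<alpha> \<beta> (THE A. is_typeI \<alpha> \<beta> \<gamma> n m A)"

definition is_typeII :: "real \<Rightarrow> real \<Rightarrow> real \<Rightarrow> nat \<Rightarrow> nat \<Rightarrow> real poly \<Rightarrow> bool" where
  "is_typeII \<alpha> \<beta> \<gamma> n m B \<longleftrightarrow>
     degree B = n + m \<and> lead_coeff B = 1 \<and>
     (\<forall>j<n. integral {0..1} (\<lambda>x. poly B x * x powr (\<alpha> + real j) * (1 - x) powr \<gamma>) = 0) \<and>
     (\<forall>j<m. integral {0..1} (\<lambda>x. poly B x * x powr (\<beta> + real j) * (1 - x) powr \<gamma>) = 0)"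

definition B_poly :: "real \<Rightarrow> real \<Rightarrow> real \<Rightarrow> nat \<Rightarrow> nat \<Rightarrow> real poly" where
  "B_poly \<alpha> \<beta> \<gamma> n m = (THE B. is_typeII \<alpha> \<beta> \<gamma> n m B)"

definition B_step :: "real \<Rightarrow> real \<Rightarrow> real \<Rightarrow> nat \<Rightarrow> real poly" where
  "B_step \<alpha> \<beta> \<gamma> k =
     (if even k then B_poly \<alpha> \<beta> \<gamma> (k div 2) (k div 2)
      else B_poly \<alpha> \<beta> \<gamma> (k div 2 + 1) (k div 2))"

text \<open>Each row of \<open>J\<close> lists the coefficients of the (finite) expansion of \<open>x B\<^sup>(\<^sup>k\<^sup>)\<close> in the
  step-line basis; the band structure of \<open>J\<close> is a consequence.\<close>

definition jacobi_matrix :: "real \<Rightarrow> real \<Rightarrow> real \<Rightarrow> nat \<Rightarrow> nat \<Rightarrow> real" where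
  "jacobi_matrix \<alpha> \<beta> \<gamma> = (THE J. \<forall>k. finite {l. J k l \<noteq> 0} \<and>
     [:0, 1:] * B_step \<alpha> \<beta> \<gamma> k = (\<Sum>l | J k l \<noteq> 0. smult (J k l) (B_step \<alpha> \<beta> \<gamma> l)))"

text \<open>The pair \<open>(n, m)\<close> is always on the step-line, i.e. \<open>n = m\<close> or \<open>n = m + 1\<close>, and so corresponds
  to row \<open>n + m\<close>; \<open>coef_c\<close> is used only for \<open>n + m \<ge> 1\<close> and \<open>coef_d\<close> only for \<open>n + m \<ge> 2\<close>.\<close>

definition coef_b :: "real \<Rightarrow> real \<Rightarrow> real \<Rightarrow> nat \<Rightarrow> nat \<Rightarrow> real" where
  "coef_b \<alpha> \<beta> \<gamma> n m = jacobi_matrix \<alpha> \<beta> \<gamma> (n + m) (n + m)"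

definition coef_c :: "real \<Rightarrow> real \<Rightarrow> real \<Rightarrow> nat \<Rightarrow> nat \<Rightarrow> real" where
  "coef_c \<alpha> \<beta> \<gamma> n m = jacobi_matrix \<alpha> \<beta> \<gamma> (n + m) (n + m - 1)"

definition coef_d :: "real \<Rightarrow> real \<Rightarrow> real \<Rightarrow> nat \<Rightarrow> nat \<Rightarrow> real" where
  "coef_d \<alpha> \<beta> \<gamma> n m = jacobi_matrix \<alpha> \<beta> \<gamma> (n + m) (n + m - 2)"

definition multiple_stochastic_typeI :: "(nat \<Rightarrow> nat \<Rightarrow> real) \<Rightarrow> bool" where
  "multiple_stochastic_typeI P \<longleftrightarrow>
     (\<forall>k l. 0 \<le> P k l) \<and>
     (\<forall>k. (\<lambda>l. P k l) sums 1) \<and>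
     (\<forall>k l. \<not> (k \<le> l + 1 \<and> l \<le> k + 2) \<longrightarrow> P k l = 0)"

end

theory Submission
  imports Defs
begin

text \<open>
  Let \<open>\<theta>\<^sub>0, \<theta>\<^sub>1, \<theta>\<^sub>2, \<dots> = \<alpha>, \<beta>, \<alpha> + 1, \<beta> + 1, \<dots>\<close>. The Mellin transform \<open>\<integral> B(x) x\<^sup>s (1 - x)\<^sup>\<gamma> dx\<close> of the
  step-line polynomial of degree \<open>N\<close> is a positive multiple of
  \<open>\<Gamma>(s + 1) / \<Gamma>(s + \<gamma> + N + 2) \<cdot> \<Prod>\<^sub>i\<^sub><\<^sub>N (s - \<theta>\<^sub>i)\<close>. Multiplication by \<open>x\<close> is the shift \<open>s \<mapsto> s + 1\<close>, so
  the four-term recurrence becomes an identity between cubics in \<open>s\<close>, from which the coefficients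
  are read off; they are nonnegative when \<open>\<bar>\<alpha> - \<beta>\<bar> < 1\<close>. The type I forms \<open>Q\<^sub>k\<close> are the basis dual to the
  polynomials \<open>B\<^sub>k\<close>, hence \<open>x Q\<^sub>k = \<Sum>\<^sub>l J\<^sub>l\<^sub>k Q\<^sub>l\<close>, and \<open>x = 1\<close> gives the row sums. Finally \<open>Q\<^sub>k(1) > 0\<close>: as a
  sum of \<open>k + 1\<close> real powers \<open>Q\<^sub>k\<close> has at most \<open>k\<close> positive zeros, and by orthogonality it
  already changes sign \<open>k\<close> times in \<open>(0, 1)\<close>.
\<close>

subsection \<open>Recurrence coefficients\<close>

text \<open>Two polynomials of degree at most 3 that agree at four points are equal. The points
  isolate the coefficients: only the \<open>c0\<close> term survives at \<open>s1\<close>, only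
  \<open>c1\<close> and \<open>c0\<close> at \<open>s2\<close>, only \<open>c3\<close> and
  \<open>c2\<close> at \<open>- g - 1\<close>, and \<open>c3\<close> alone at
  \<open>- g - 2\<close>.\<close>

lemma four_term_identity:
  fixes a b g s1 s2 s3 c0 c1 c2 c3 :: real
  assumes dist: "s1 \<noteq> s2" "s1 > - g - 1" "s2 > - g - 1"
    and at: "\<And>s. s \<in> {s1, s2, - g - 1, - g - 2} \<Longrightarrow>
      (s + 1) * (s + 1 - a) * (s + 1 - b) =
        c3 * ((s - s1) * (s - s2) * (s - s3)) + c2 * ((s - s1) * (s - s2) * (s + g + 2)) +
        c1 * ((s - s1) * (s + g + 1) * (s + g + 2)) + c0 * ((s + g) * (s + g + 1) * (s + g + 2))"
  shows "(s + 1) * (s + 1 - a) * (s + 1 - b) =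
        c3 * ((s - s1) * (s - s2) * (s - s3)) + c2 * ((s - s1) * (s - s2) * (s + g + 2)) +
        c1 * ((s - s1) * (s + g + 1) * (s + g + 2)) + c0 * ((s + g) * (s + g + 1) * (s + g + 2))"
proof -
  define P where "P = [:1, 1:] * [:1 - a, 1:] * [:1 - b, 1:]"
  define R where "R = smult c3 ([:-s1, 1:] * [:-s2, 1:] * [:-s3, 1:])
     + smult c2 ([:-s1, 1:] * [:-s2, 1:] * [:g + 2, 1:])
     + smult c1 ([:-s1, 1:] * [:g + 1, 1:] * [:g + 2, 1:])
     + smult c0 ([:g, 1:] * [:g + 1, 1:] * [:g + 2, 1:])"
  have P: "poly P s = (s + 1) * (s + 1 - a) * (s + 1 - b)" for s
    by (simp add: P_def algebra_simps)
  have R: "poly R s = c3 * ((s - s1) * (s - s2) * (s - s3)) + c2 * ((s - s1) * (s - s2) * (s + g + 2)) +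
        c1 * ((s - s1) * (s + g + 1) * (s + g + 2)) + c0 * ((s + g) * (s + g + 1) * (s + g + 2))" for s
    by (simp add: R_def algebra_simps)
  have deg3: "degree ([:x, 1:] * [:y, 1:] * [:z, 1:]) \<le> 3" for x y z :: real
    by simp
  have "P = R"
  proof (rule poly_eqI_degree[where A = "{s1, s2, - g - 1, - g - 2}"])
    have card: "card {s1, s2, - g - 1, - g - 2} = 4" using dist by auto
    have "degree P \<le> 3" unfolding P_def by (rule deg3)
    then show "degree P < card {s1, s2, - g - 1, - g - 2}" using card by simp
    have "degree R \<le> 3" unfolding R_def
      by (intro degree_add_le order_trans[OF degree_smult_le] deg3)
    then show "degree R < card {s1, s2, - g - 1, - g - 2}" using card by simp
    show "poly P x = poly R x" if "x \<in> {s1, s2, - g - 1, - g - 2}" for x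
      unfolding P R by (rule at[OF that])
  qed
  then show ?thesis using P[of s] R[of s] by simp
qed

section \<open>Signs of the interpolated coefficients\<close>

lemma shifted_quotient_mono:
  fixes s u c d :: real
  assumes "s \<le> u" "c \<le> d" "s + d > 0"
  shows "(s + c) / (s + d) \<le> (u + c) / (u + d)"
proof -
  have "(s + c) * (u + d) \<le> (u + c) * (s + d)"
    using mult_nonneg_nonneg[of "u - s" "d - c"] assms by (simp add: algebra_simps)
  moreover have "s + d > 0" "u + d > 0" using assms by auto
  ultimately show ?thesis by (simp add: pos_divide_le_eq pos_le_divide_eq)
qed

text \<open>The quotient splits into three factors \<open>(s + c) / (s + d)\<close> with
  \<open>c \<le> d\<close>, each increasing in \<open>s\<close>; positive numerators allow the three
  inequalities to be multiplied.\<close>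

lemma cubic_quotient_mono:
  fixes a b g s u :: real
  assumes "s \<le> u" "g > 1" "a + g > 0" "b + g > 0" "s + 1 > 0" "s + 1 - a > 0" "s + 1 - b > 0"
  shows "(s + 1) * (s + 1 - a) * (s + 1 - b) / ((s + g) * (s + g + 1) * (s + g + 2)) \<le>
         (u + 1) * (u + 1 - a) * (u + 1 - b) / ((u + g) * (u + g + 1) * (u + g + 2))"
proof -
  have "(s + 1) / (s + g) * ((s + (1 - a)) / (s + (g + 1))) * ((s + (1 - b)) / (s + (g + 2)))
    \<le> (u + 1) / (u + g) * ((u + (1 - a)) / (u + (g + 1))) * ((u + (1 - b)) / (u + (g + 2)))"
    using assms by (intro mult_mono shifted_quotient_mono mult_nonneg_nonneg divide_nonneg_nonneg) auto
  moreover have "x + 1 - a = x + (1 - a)" "x + 1 - b = x + (1 - b)" "x + g + 1 = x + (g + 1)" "x + g + 2 = x + (g + 2)" for x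
    by simp_all
  ultimately show ?thesis by (simp only: times_divide_times_eq)
qed

text \<open>With \<open>A = g + a\<close> and \<open>B = g + b\<close> the claim is the product of
  \<open>B / (B + t) \<le> (B + 1) / (B + t + 1)\<close> and
  \<open>g * A / (A + n) \<le> (g + 1) * (A + 1) / (A + n + 2)\<close>. It yields the sign of
  \<open>c2\<close> below, hence of the diagonal Jacobi entries.\<close>

lemma diagonal_coefficient_nonneg:
  fixes a b g n t :: real
  assumes "a > -1" "b > -1" "n \<ge> 1" "t \<ge> 1" "g > 0" "a + g > 0" "b + g > 0"
  shows "g * (g + a) * (g + b) / ((a + n + g) * (b + t + g)) \<le>
    (g + 1) * (g + 1 + a) * (g + 1 + b) / ((a + n + g + 2) * (b + t + g + 1))"
proof -
  define A where "A = g + a"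
  define B where "B = g + b"
  have pos: "A > 0" "B > 0" using assms by (auto simp: A_def B_def)
  have 1: "B * (B + t + 1) \<le> (B + 1) * (B + t)"
    using assms by (simp add: algebra_simps)
  have "(g + 1) * (A + 1) * (A + n) - g * A * (A + n + 2) = A * (n + (a + 1)) + n * (g + 1)"
    by (simp add: A_def algebra_simps)
  moreover have "A * (n + (a + 1)) \<ge> 0" "n * (g + 1) \<ge> 0" using pos assms by auto
  ultimately have 2: "g * A * (A + n + 2) \<le> (g + 1) * (A + 1) * (A + n)" by simp
  have "(g * A * (A + n + 2)) * (B * (B + t + 1)) \<le> ((g + 1) * (A + 1) * (A + n)) * ((B + 1) * (B + t))"
    using pos assms by (intro mult_mono 1 2) auto
  then have "g * A * B / ((A + n) * (B + t)) \<le> (g + 1) * (A + 1) * (B + 1) / ((A + n + 2) * (B + t + 1))"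
    using pos assms by (simp add: divide_simps) (simp add: mult_ac)
  then show ?thesis by (simp add: A_def B_def add_ac)
qed

text \<open>This is the recurrence of level \<open>N \<ge> 2\<close> after cancellation of the
  common node factor: \<open>s1\<close> and \<open>s2\<close> are the last two nodes,
  \<open>t\<close> distinguishes the parities, and \<open>g\<close> stands for \<gamma> + N.\<close>

lemma four_term_coefficients:
  fixes a b g n t :: real
  assumes a: "a > -1" and b: "b > -1" and ab: "a \<noteq> b" "\<bar>a - b\<bar> < 1"
    and n: "n \<ge> 1" and t: "t = n \<or> t = n + 1" and g: "g > 1"
  defines "s1 \<equiv> a + n - 1" and "s2 \<equiv> b + t - 1"
  shows "\<exists>c3 c2 c1 c0. c3 > 0 \<and> c2 \<ge> 0 \<and> c1 \<ge> 0 \<and> c0 \<ge> 0 \<and>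
    (\<forall>s. (s + 1) * (s + 1 - a) * (s + 1 - b) =
        c3 * ((s - s1) * (s - s2) * (s - (s1 + 1))) + c2 * ((s - s1) * (s - s2) * (s + g + 2)) +
        c1 * ((s - s1) * (s + g + 1) * (s + g + 2)) + c0 * ((s + g) * (s + g + 1) * (s + g + 2)))"
proof -
  define f where "f s = (s + 1) * (s + 1 - a) * (s + 1 - b) / ((s + g) * (s + g + 1) * (s + g + 2))" for s
  have s12: "s1 \<noteq> s2" using t ab by (auto simp: s1_def s2_def)
  have g': "a + g > 0" "b + g > 0" using a b g by auto
  have t1: "t \<ge> 1" using t n by auto
  \<comment> \<open>\<open>s1 + 1 - b\<close> equals \<open>a - b + n\<close> and
    \<open>s2 + 1 - a\<close> equals \<open>b - a + t\<close>, so |a - b| < 1 and n, t \<ge> 1 keep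
    these mixed factors positive.\<close>
  have p1: "s1 + 1 > 0" "s1 + 1 - a > 0" "s1 + 1 - b > 0" and p2: "s2 + 1 > 0" "s2 + 1 - a > 0" "s2 + 1 - b > 0"
    using a b ab t n by (auto simp: s1_def s2_def)
  have q: "s1 + g > 0" "s2 + g > 0" using p1 p2 g by auto
  \<comment> \<open>Evaluation at \<open>s1\<close> gives \<open>c0\<close>; at \<open>s2\<close>,
    with the \<open>c0\<close> term removed, it gives a divided difference of \<open>f\<close> times
    \<open>s2 + g\<close>; at \<open>- g - 2\<close> and then \<open>- g - 1\<close> it gives
    \<open>c3\<close> and \<open>c2\<close>.\<close>
  define c0 where "c0 = f s1"
  define c1 where "c1 = (f s2 - f s1) / (s2 - s1) * (s2 + g)"
  define c3 where "c3 = (g + 1) * (g + 1 + a) * (g + 1 + b) / ((s1 + g + 2) * (s2 + g + 2) * (s1 + g + 3))"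
  define c2 where "c2 = c3 * (s1 + g + 2) - g * (g + a) * (g + b) / ((s1 + g + 1) * (s2 + g + 1))"
  have "c3 > 0" using p1 p2 q g g' by (auto simp: c3_def intro!: divide_pos_pos mult_pos_pos)
  moreover have "c0 \<ge> 0" unfolding c0_def f_def
    using p1 q by (intro divide_nonneg_nonneg mult_nonneg_nonneg) auto
  moreover have "c1 \<ge> 0"
  \<comment> \<open>\<open>c1\<close> has the sign of a difference quotient of the increasing
    function \<open>f\<close>; which of \<open>s1\<close> and \<open>s2\<close> is larger depends on
    the parameters.\<close>
  proof (cases "s1 \<le> s2")
    case True
    then have "f s1 \<le> f s2" unfolding f_def using p1 g g' by (intro cubic_quotient_mono) auto
    then show ?thesis using True q by (auto simp: c1_def)
  next
    case False
    then have "f s2 \<le> f s1" unfolding f_def using p2 g g' by (intro cubic_quotient_mono) auto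
    then show ?thesis using False q unfolding c1_def
      by (intro mult_nonneg_nonneg divide_nonpos_nonpos) auto
  qed
  moreover have "c2 \<ge> 0"
  proof -
    have "c3 * (s1 + g + 2) = (g + 1) * (g + 1 + a) * (g + 1 + b) / ((s1 + g + 3) * (s2 + g + 2))"
      using q by (simp add: c3_def mult_ac)
    moreover have "g * (g + a) * (g + b) / ((s1 + g + 1) * (s2 + g + 1)) \<le>
       (g + 1) * (g + 1 + a) * (g + 1 + b) / ((s1 + g + 3) * (s2 + g + 2))"
      using diagonal_coefficient_nonneg[of a b n t g] a b n t1 g g' by (simp add: s1_def s2_def add_ac)
    ultimately show ?thesis by (simp add: c2_def)
  qed
  moreover have "(s + 1) * (s + 1 - a) * (s + 1 - b) =
        c3 * ((s - s1) * (s - s2) * (s - (s1 + 1))) + c2 * ((s - s1) * (s - s2) * (s + g + 2)) +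
        c1 * ((s - s1) * (s + g + 1) * (s + g + 2)) + c0 * ((s + g) * (s + g + 1) * (s + g + 2))" for s
  proof (rule four_term_identity[OF s12])
    show "s1 > - g - 1" "s2 > - g - 1" using q by auto
    fix s assume "s \<in> {s1, s2, - g - 1, - g - 2}"
    then consider "s = s1" | "s = s2" | "s = - g - 1" | "s = - g - 2" by auto
    then show "(s + 1) * (s + 1 - a) * (s + 1 - b) =
        c3 * ((s - s1) * (s - s2) * (s - (s1 + 1))) + c2 * ((s - s1) * (s - s2) * (s + g + 2)) +
        c1 * ((s - s1) * (s + g + 1) * (s + g + 2)) + c0 * ((s + g) * (s + g + 1) * (s + g + 2))"
    proof cases
      case 1
      show ?thesis using q by (simp add: 1 c0_def f_def)
    next
      case 2
      have "c1 * ((s2 - s1) * (s2 + g + 1) * (s2 + g + 2)) = (f s2 - f s1) * ((s2 + g) * (s2 + g + 1) * (s2 + g + 2))"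
        using s12 by (simp add: c1_def)
      moreover have "f s2 * ((s2 + g) * (s2 + g + 1) * (s2 + g + 2)) = (s2 + 1) * (s2 + 1 - a) * (s2 + 1 - b)"
        using q by (simp add: f_def)
      ultimately show ?thesis by (simp add: 2 c0_def left_diff_distrib)
    next
      case 3
      have "(- g - 1 - s1) * (- g - 1 - s2) = (s1 + g + 1) * (s2 + g + 1)" by algebra
      moreover have "c2 * ((s1 + g + 1) * (s2 + g + 1)) =
          c3 * (s1 + g + 2) * ((s1 + g + 1) * (s2 + g + 1)) - g * (g + a) * (g + b)"
        using q by (simp add: c2_def left_diff_distrib)
      ultimately show ?thesis unfolding 3 by algebra
    next
      case 4
      have "c3 * ((s1 + g + 2) * (s2 + g + 2) * (s1 + g + 3)) = (g + 1) * (g + 1 + a) * (g + 1 + b)"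
        using q by (simp add: c3_def)
      then show ?thesis unfolding 4 by algebra
    qed
  qed
  ultimately show ?thesis by blast
qed

section \<open>Interlaced nodes and the recurrence of their products\<close>

definition node :: "real \<Rightarrow> real \<Rightarrow> nat \<Rightarrow> real" where
  "node \<alpha> \<beta> i = (if even i then \<alpha> else \<beta>) + real (i div 2)"

text \<open>For \<open>s > -1\<close> this is, up to a positive factor, the Mellin transform of the
  step-line polynomial of degree \<open>N\<close>; its zeros are the exponents to which that
  polynomial is orthogonal.\<close>

definition node_prod :: "real \<Rightarrow> real \<Rightarrow> nat \<Rightarrow> real \<Rightarrow> real" where
  "node_prod \<alpha> \<beta> N s = (\<Prod>i<N. s - node \<alpha> \<beta> i)"

lemma node_simps [simp]: "node \<alpha> \<beta> 0 = \<alpha>" "node \<alpha> \<beta> (Suc 0) = \<beta>"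
  "node \<alpha> \<beta> (Suc (Suc i)) = node \<alpha> \<beta> i + 1"
  by (auto simp: node_def)

lemma node_prod_0 [simp]: "node_prod \<alpha> \<beta> 0 s = 1"
  and node_prod_Suc: "node_prod \<alpha> \<beta> (Suc N) s = node_prod \<alpha> \<beta> N s * (s - node \<alpha> \<beta> N)"
  by (simp_all add: node_prod_def)

text \<open>Nodes two places apart differ by 1, so a unit shift of \<open>s\<close> moves the
  factors two places down and leaves the first two over.\<close>

lemma node_prod_shift:
  "node_prod \<alpha> \<beta> (Suc (Suc N)) (s + 1) = (s + 1 - \<alpha>) * (s + 1 - \<beta>) * node_prod \<alpha> \<beta> N s"
  by (simp add: node_prod_def prod.lessThan_Suc_shift del: prod.lessThan_Suc)

text \<open>For \<open>N \<ge> 2\<close> every term contains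
  \<open>node_prod \<alpha> \<beta> (N - 2) s\<close>, and cancelling it leaves the cubic identity.
  For \<open>N < 2\<close> the identity has degree \<open>N + 1\<close> and is solved directly. The
  clauses on \<open>c1\<close> and \<open>c0\<close> make the truncated indices \<open>N - 1\<close>
  and \<open>N - 2\<close> harmless.\<close>

lemma node_prod_recurrence:
  assumes a: "\<alpha> > -1" and b: "\<beta> > -1" and c: "\<gamma> > -1" and ab: "\<alpha> \<noteq> \<beta>" "\<bar>\<alpha> - \<beta>\<bar> < 1"
  shows "\<exists>c3 c2 c1 c0. c3 > 0 \<and> c2 \<ge> 0 \<and> c1 \<ge> 0 \<and> c0 \<ge> 0 \<and> (N = 0 \<longrightarrow> c1 = 0) \<and> (N < 2 \<longrightarrow> c0 = 0) \<and>
    (\<forall>s. (s + 1) * node_prod \<alpha> \<beta> N (s + 1) =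
        c3 * node_prod \<alpha> \<beta> (Suc N) s + c2 * (node_prod \<alpha> \<beta> N s * (s + \<gamma> + N + 2)) +
        c1 * (node_prod \<alpha> \<beta> (N - 1) s * ((s + \<gamma> + N + 1) * (s + \<gamma> + N + 2))) +
        c0 * (node_prod \<alpha> \<beta> (N - 2) s * ((s + \<gamma> + N) * (s + \<gamma> + N + 1) * (s + \<gamma> + N + 2))))"
proof -
  consider "N = 0" | "N = Suc 0" | M where "N = Suc (Suc M)" by (metis not0_implies_Suc)
  then show ?thesis
  proof cases
    case 1
    \<comment> \<open>Both values come from
      \<open>s + 1 = c3 * (s - \<alpha>) + c2 * (s + \<gamma> + 2)\<close>, evaluated at
      \<open>- \<gamma> - 2\<close> and at \<open>\<alpha>\<close>.\<close>
    define c3 where "c3 = (\<gamma> + 1) / (\<alpha> + \<gamma> + 2)"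
    define c2 where "c2 = (\<alpha> + 1) / (\<alpha> + \<gamma> + 2)"
    have e: "c2 * (\<alpha> + \<gamma> + 2) = \<alpha> + 1" "c3 + c2 = 1"
      using a c by (simp_all add: c3_def c2_def add_divide_distrib[symmetric])
    have "s + 1 = c3 * (s - \<alpha>) + c2 * (s + \<gamma> + 2)" for s using e by algebra
    moreover have "c3 > 0" "c2 \<ge> 0" using a c by (auto simp: c3_def c2_def)
    ultimately show ?thesis
      by (intro exI[of _ c3] exI[of _ c2] exI[of _ 0]) (simp add: 1 node_prod_Suc)
  next
    case 2
    define g where "g = \<gamma> + 1"
    have g: "g > 0" using c by (simp add: g_def)
    \<comment> \<open>The identity is now quadratic: \<open>- g - 2\<close> determines
      \<open>c3\<close>, then \<open>- g - 1\<close> determines \<open>c2\<close>, and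
      \<open>\<alpha>\<close> determines \<open>c1\<close>.\<close>
    define c3 where "c3 = (g + 1) * (g + 1 + \<alpha>) / ((g + 2 + \<alpha>) * (g + 2 + \<beta>))"
    define c2 where "c2 = (g + 1) * (g + 1 + \<alpha>) / ((g + 2 + \<alpha>) * (g + 2 + \<beta>)) * (g + 1 + \<beta>) - g * (g + \<alpha>) / (g + 1 + \<alpha>)"
    define c1 where "c1 = (\<alpha> + 1) / ((\<alpha> + g + 1) * (\<alpha> + g + 2))"
    have "c3 > 0" "c1 \<ge> 0" using a b g by (auto simp: c3_def c1_def intro!: divide_pos_pos mult_pos_pos)
    moreover have "c2 \<ge> 0"
    \<comment> \<open>Here \<open>g\<close> is only known to be positive, so
      \<open>g + \<alpha>\<close> may fail to be; in that case the term subtracted in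
      \<open>c2\<close> is nonpositive.\<close>
    proof (cases "g + \<alpha> \<le> 0")
      case True
      then have "g * (g + \<alpha>) / (g + 1 + \<alpha>) \<le> 0" using g a
        by (intro divide_nonpos_nonneg mult_nonneg_nonpos) auto
      moreover have "(g + 1) * (g + 1 + \<alpha>) / ((g + 2 + \<alpha>) * (g + 2 + \<beta>)) * (g + 1 + \<beta>) \<ge> 0"
        using a b g by (intro divide_nonneg_nonneg mult_nonneg_nonneg) auto
      ultimately show ?thesis by (simp add: c2_def)
    next
      case False
      have 1: "(g + \<alpha>) * (g + 2 + \<alpha>) \<le> (g + 1 + \<alpha>) * (g + 1 + \<alpha>)" by (simp add: algebra_simps)
      have 2: "g * (g + 2 + \<beta>) \<le> (g + 1) * (g + 1 + \<beta>)" using b by (simp add: algebra_simps)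
      have "((g + \<alpha>) * (g + 2 + \<alpha>)) * (g * (g + 2 + \<beta>)) \<le> ((g + 1 + \<alpha>) * (g + 1 + \<alpha>)) * ((g + 1) * (g + 1 + \<beta>))"
        using False a b g by (intro mult_mono 1 2) auto
      moreover have "g + 2 + \<alpha> > 0" "g + 2 + \<beta> > 0" "g + 1 + \<alpha> > 0" using a b g by auto
      ultimately have "g * (g + \<alpha>) / (g + 1 + \<alpha>) \<le> (g + 1) * (g + 1 + \<alpha>) * (g + 1 + \<beta>) / ((g + 2 + \<alpha>) * (g + 2 + \<beta>))"
        by (simp add: pos_divide_le_eq pos_le_divide_eq mult_ac)
      then show ?thesis by (simp add: c2_def)
    qed
    moreover have "(s + 1) * (s + 1 - \<alpha>) = c3 * ((s - \<alpha>) * (s - \<beta>)) + c2 * ((s - \<alpha>) * (s + g + 2)) +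
        c1 * ((s + g + 1) * (s + g + 2))" for s
    proof -
      have e1: "c1 * ((\<alpha> + g + 1) * (\<alpha> + g + 2)) = \<alpha> + 1"
        using a g by (simp add: c1_def)
      have e3: "c3 * ((g + 2 + \<alpha>) * (g + 2 + \<beta>)) = (g + 1) * (g + 1 + \<alpha>)"
        using a b g by (simp add: c3_def)
      have "c2 = c3 * (g + 1 + \<beta>) - g * (g + \<alpha>) / (g + 1 + \<alpha>)" by (simp add: c2_def c3_def)
      then have e2: "c2 * (g + 1 + \<alpha>) = c3 * (g + 1 + \<beta>) * (g + 1 + \<alpha>) - g * (g + \<alpha>)"
        using a g by (simp add: left_diff_distrib)
      define P where "P = [:1, 1:] * [:1 - \<alpha>, 1:]"
      define R where "R = smult c3 ([:-\<alpha>, 1:] * [:-\<beta>, 1:]) + smult c2 ([:-\<alpha>, 1:] * [:g + 2, 1:])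
        + smult c1 ([:g + 1, 1:] * [:g + 2, 1:])"
      have P: "poly P s = (s + 1) * (s + 1 - \<alpha>)" for s by (simp add: P_def algebra_simps)
      have R: "poly R s = c3 * ((s - \<alpha>) * (s - \<beta>)) + c2 * ((s - \<alpha>) * (s + g + 2)) +
        c1 * ((s + g + 1) * (s + g + 2))" for s by (simp add: R_def algebra_simps)
      have deg2: "degree ([:x, 1:] * [:y, 1:]) \<le> 2" for x y :: real by simp
      have "P = R"
      proof (rule poly_eqI_degree[where A = "{\<alpha>, - g - 1, - g - 2}"])
        have card: "card {\<alpha>, - g - 1, - g - 2} = 3" using a g by auto
        have "degree P \<le> 2" unfolding P_def by (rule deg2)
        then show "degree P < card {\<alpha>, - g - 1, - g - 2}" using card by simp
        have "degree R \<le> 2" unfolding R_def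
          by (intro degree_add_le order_trans[OF degree_smult_le] deg2)
        then show "degree R < card {\<alpha>, - g - 1, - g - 2}" using card by simp
        have "poly P \<alpha> = poly R \<alpha>" unfolding P R using e1 by simp
        moreover have "poly P (- g - 1) = poly R (- g - 1)" unfolding P R using e2 by algebra
        moreover have "poly P (- g - 2) = poly R (- g - 2)" unfolding P R using e3 by algebra
        ultimately show "poly P x = poly R x" if "x \<in> {\<alpha>, - g - 1, - g - 2}" for x
          using that by auto
      qed
      then show ?thesis using P[of s] R[of s] by simp
    qed
    ultimately show ?thesis
      by (intro exI[of _ c3] exI[of _ c2] exI[of _ c1] exI[of _ 0])
        (auto simp: 2 node_prod_Suc g_def add_ac)
  next
    case 3
    define g where "g = \<gamma> + N"
    define n where "n = real (Suc (M div 2))"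
    have "\<exists>c3 c2 c1 c0. c3 > 0 \<and> c2 \<ge> 0 \<and> c1 \<ge> 0 \<and> c0 \<ge> 0 \<and>
      (\<forall>s. (s + 1) * (s + 1 - \<alpha>) * (s + 1 - \<beta>) =
        c3 * ((s - node \<alpha> \<beta> M) * (s - node \<alpha> \<beta> (Suc M)) * (s - (node \<alpha> \<beta> M + 1))) +
        c2 * ((s - node \<alpha> \<beta> M) * (s - node \<alpha> \<beta> (Suc M)) * (s + g + 2)) +
        c1 * ((s - node \<alpha> \<beta> M) * (s + g + 1) * (s + g + 2)) + c0 * ((s + g) * (s + g + 1) * (s + g + 2)))"
    proof (cases "even M")
      case True
      then have "node \<alpha> \<beta> M = \<alpha> + n - 1" "node \<alpha> \<beta> (Suc M) = \<beta> + n - 1"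
        by (auto simp: node_def n_def)
      then show ?thesis
        using four_term_coefficients[of \<alpha> \<beta> n n g] a b c ab by (simp add: n_def g_def 3)
    next
      \<comment> \<open>For odd \<open>M\<close> the last two nodes come in the order \<beta>,
        \<alpha>, so the parameters trade places and \<open>t\<close> is
        \<open>n + 1\<close>.\<close>
      case False
      then have "node \<alpha> \<beta> M = \<beta> + n - 1" "node \<alpha> \<beta> (Suc M) = \<alpha> + (n + 1) - 1"
        by (auto simp: node_def n_def)
      moreover have "\<bar>\<beta> - \<alpha>\<bar> < 1" using ab by simp
      ultimately show ?thesis
        using four_term_coefficients[of \<beta> \<alpha> n "n + 1" g] a b c ab(1) by (simp add: n_def g_def 3 mult_ac)
    qed
    then obtain c3 c2 c1 c0 where pos: "c3 > 0" "c2 \<ge> 0" "c1 \<ge> 0" "c0 \<ge> 0"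
      and id: "\<And>s. (s + 1) * (s + 1 - \<alpha>) * (s + 1 - \<beta>) =
        c3 * ((s - node \<alpha> \<beta> M) * (s - node \<alpha> \<beta> (Suc M)) * (s - (node \<alpha> \<beta> M + 1))) +
        c2 * ((s - node \<alpha> \<beta> M) * (s - node \<alpha> \<beta> (Suc M)) * (s + g + 2)) +
        c1 * ((s - node \<alpha> \<beta> M) * (s + g + 1) * (s + g + 2)) + c0 * ((s + g) * (s + g + 1) * (s + g + 2))"
      by blast
    have "(s + 1) * node_prod \<alpha> \<beta> N (s + 1) = 
        c3 * node_prod \<alpha> \<beta> (Suc N) s + c2 * (node_prod \<alpha> \<beta> N s * (s + \<gamma> + N + 2)) +
        c1 * (node_prod \<alpha> \<beta> (N - 1) s * ((s + \<gamma> + N + 1) * (s + \<gamma> + N + 2))) +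
        c0 * (node_prod \<alpha> \<beta> (N - 2) s * ((s + \<gamma> + N) * (s + \<gamma> + N + 1) * (s + \<gamma> + N + 2)))" for s
    proof -
      define X where "X = node_prod \<alpha> \<beta> M s"
      define x1 x2 x3 where "x1 = s - node \<alpha> \<beta> M" and "x2 = s - node \<alpha> \<beta> (Suc M)" and "x3 = s - (node \<alpha> \<beta> M + 1)"
      define y0 y1 y2 where "y0 = s + g" and "y1 = s + g + 1" and "y2 = s + g + 2"
      have "node_prod \<alpha> \<beta> N s = X * x1 * x2" "node_prod \<alpha> \<beta> (Suc N) s = X * x1 * x2 * x3"
        "node_prod \<alpha> \<beta> (N - 1) s = X * x1" "node_prod \<alpha> \<beta> (N - 2) s = X"
        by (simp_all add: 3 node_prod_Suc X_def x1_def x2_def x3_def)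
      moreover have "s + \<gamma> + N = y0" "s + \<gamma> + N + 1 = y1" "s + \<gamma> + N + 2 = y2"
        by (simp_all add: y0_def y1_def y2_def g_def)
      moreover have "(s + 1) * node_prod \<alpha> \<beta> N (s + 1) = (s + 1) * (s + 1 - \<alpha>) * (s + 1 - \<beta>) * X"
        by (simp add: 3 node_prod_shift X_def)
      moreover have "(s + 1) * (s + 1 - \<alpha>) * (s + 1 - \<beta>) =
          c3 * (x1 * x2 * x3) + c2 * (x1 * x2 * y2) + c1 * (x1 * y1 * y2) + c0 * (y0 * y1 * y2)"
        unfolding x1_def x2_def x3_def y0_def y1_def y2_def by (rule id)
      ultimately show ?thesis by (simp only:) (simp only: ring_distribs mult_ac)
    qed
    then show ?thesis using pos 3 by (intro exI[of _ c3] exI[of _ c2] exI[of _ c1] exI[of _ c0]) simp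
  qed
qed

subsection \<open>Zeros and sign changes of sums of real powers\<close>

text \<open>Consecutive zeros enclose a zero of the derivative. Keeping \<open>W\<close> below
  \<open>Max Z\<close> lets the induction add a new largest zero: the zero of \<open>f'\<close>
  found beyond the old maximum cannot belong to \<open>W\<close>.\<close>

lemma Rolle_zeros:
  fixes f f' :: "real \<Rightarrow> real"
  assumes "finite Z" "Z \<noteq> {}" "Z \<subseteq> {0<..}" "\<And>z. z \<in> Z \<Longrightarrow> f z = 0"
    and deriv: "\<And>x. x > 0 \<Longrightarrow> (f has_real_derivative f' x) (at x)"
  shows "\<exists>W. finite W \<and> Suc (card W) = card Z \<and> W \<subseteq> {0<..<Max Z} \<and> (\<forall>w\<in>W. f' w = 0)"
  using assms(1-4)
proof (induction Z rule: finite_linorder_max_induct)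
  case empty
  then show ?case by simp
next
  case (insert b A)
  show ?case
  proof (cases "A = {}")
    case True
    then show ?thesis by (intro exI[of _ "{}"]) simp
  next
    case False
    define a where "a = Max A"
    have aA: "a \<in> A" using insert.hyps False by (simp add: a_def)
    obtain W where W: "finite W" "Suc (card W) = card A" "W \<subseteq> {0<..<a}" "\<forall>w\<in>W. f' w = 0"
      using insert.IH[OF False] insert.prems by (auto simp: a_def)
    have ab: "0 < a" "a < b" using aA insert.hyps insert.prems by auto
    have "\<exists>z>a. z < b \<and> f' z = 0"
    proof (rule Rolle_deriv[where f' = "\<lambda>x h. f' x * h", THEN exE])
      show "a < b" by fact
      show "f a = f b" using insert.prems aA by auto
      show "continuous_on {a..b} f"
        using ab by (intro DERIV_continuous_on[of _ _ f']) (auto intro!: DERIV_subset[OF deriv])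
      show "(f has_derivative (\<lambda>h. f' x * h)) (at x)" if "a < x" "x < b" for x
        using deriv[of x] that ab by (simp add: has_field_derivative_def)
      fix z assume z: "a < z \<and> z < b \<and> (\<lambda>h. f' z * h) = (\<lambda>v. 0)"
      then have "(\<lambda>h. f' z * h) = (\<lambda>v. 0)" by blast
      from fun_cong[OF this, of 1] have "f' z = 0" by simp
      moreover have "a < z" "z < b" using z by blast+
      ultimately show "\<exists>z>a. z < b \<and> f' z = 0" by blast
    qed
    then obtain z where z: "a < z" "z < b" "f' z = 0" by blast
    have "Max (insert b A) = b"
      using insert.hyps by (intro Max_eqI) (auto intro: less_imp_le)
    moreover have "z \<notin> W" using W(3) z by auto
    ultimately show ?thesis using W z ab insert.hyps
      by (intro exI[of _ "insert z W"]) (auto simp: less_imp_not_eq)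
  qed
qed

text \<open>Multiplying by \<open>x powr (- s i)\<close> makes the \<open>i\<close>-th term constant
  and keeps the positive zeros. Differentiation removes that term, and Rolle costs one zero, so
  induction on the number of exponents applies.\<close>

lemma powr_sum_zeros:
  fixes q s :: "'i \<Rightarrow> real"
  assumes "finite I" "inj_on s I" "i \<in> I" "q i \<noteq> 0"
    and "finite Z" "Z \<subseteq> {0<..}" "\<And>x. x \<in> Z \<Longrightarrow> (\<Sum>i\<in>I. q i * x powr s i) = 0"
  shows "card Z < card I"
  using assms
proof (induction "card I" arbitrary: I q s i Z)
  case 0
  then show ?case by auto
next
  case (Suc N)
  show ?case
  proof (cases "Z = {}")
    case True
    then show ?thesis using Suc.prems by (auto simp: card_gt_0_iff)
  next
    case False
    show ?thesis
    proof (cases "\<exists>j\<in>I. j \<noteq> i \<and> q j \<noteq> 0")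
      \<comment> \<open>A second nonzero coefficient is what keeps the derivative nontrivial.
        Without one, the sum is a nonzero multiple of a single power and has no positive
        zero.\<close>
      case False
      obtain z where z: "z \<in> Z" using \<open>Z \<noteq> {}\<close> by blast
      have "(\<Sum>j\<in>I. q j * z powr s j) = (\<Sum>j\<in>{i}. q j * z powr s j)"
        using Suc.prems False by (intro sum.mono_neutral_right) auto
      then have "z powr s i = 0" using Suc.prems z by auto
      then show ?thesis using Suc.prems z by auto
    next
      case True
      then obtain j where j: "j \<in> I" "j \<noteq> i" "q j \<noteq> 0" by blast
      define J where "J = I - {i}"
      define f where "f x = (\<Sum>l\<in>I. q l * x powr (s l - s i))" for x
      define f' where "f' x = (\<Sum>l\<in>J. (q l * (s l - s i)) * x powr (s l - s i - 1))" for x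
      have "f z = 0" if "z \<in> Z" for z
      proof -
        have "f z = (\<Sum>l\<in>I. q l * z powr s l) * z powr (- s i)"
          unfolding f_def sum_distrib_right by (simp add: powr_diff powr_minus divide_simps)
        then show ?thesis using Suc.prems that by auto
      qed
      moreover have "(f has_real_derivative f' x) (at x)" if "x > 0" for x
      proof -
        have "(f has_real_derivative (\<Sum>l\<in>I. q l * ((s l - s i) * x powr (s l - s i - 1)))) (at x)"
          unfolding f_def using that by (auto intro!: derivative_eq_intros sum.cong)
        also have "(\<Sum>l\<in>I. q l * ((s l - s i) * x powr (s l - s i - 1))) = f' x"
          unfolding f'_def J_def using Suc.prems by (intro sum.mono_neutral_cong_right) auto
        finally show ?thesis .
      qed
      ultimately obtain W where W: "finite W" "Suc (card W) = card Z" "W \<subseteq> {0<..<Max Z}" "\<forall>w\<in>W. f' w = 0"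
        using Rolle_zeros[of Z f f'] Suc.prems \<open>Z \<noteq> {}\<close> by blast
      have "card W < card J"
      proof (rule Suc.hyps(1))
        show "N = card J" "finite J" using Suc.hyps(2) Suc.prems by (auto simp: J_def)
        show "inj_on (\<lambda>l. s l - s i - 1) J"
          using Suc.prems(2) by (auto simp: J_def inj_on_def)
        show "j \<in> J" using j by (simp add: J_def)
        show "q j * (s j - s i) \<noteq> 0" using j Suc.prems by (auto simp: inj_on_def)
        show "finite W" "W \<subseteq> {0<..}" using W by auto
        show "(\<Sum>l\<in>J. (q l * (s l - s i)) * x powr (s l - s i - 1)) = 0" if "x \<in> W" for x
          using W(4) that by (simp add: f'_def)
      qed
      moreover have "card I = Suc (card J)" using Suc.prems Suc.hyps(2) by (simp add: J_def)
      ultimately show ?thesis using W by simp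
    qed
  qed
qed

corollary finite_powr_sum_zeros:
  fixes q s :: "'i \<Rightarrow> real"
  assumes "finite I" "inj_on s I" "i \<in> I" "q i \<noteq> 0"
  shows "finite {x. x > 0 \<and> (\<Sum>i\<in>I. q i * x powr s i) = 0}"
proof (rule ccontr)
  assume "infinite {x. x > 0 \<and> (\<Sum>i\<in>I. q i * x powr s i) = 0}"
  then obtain Z where "Z \<subseteq> {x. x > 0 \<and> (\<Sum>i\<in>I. q i * x powr s i) = 0}" "card Z = card I" "finite Z"
    using infinite_arbitrarily_large by blast
  then show False using powr_sum_zeros[of I s i q Z] assms by auto
qed

section \<open>Sign changes on an interval\<close>

lemma constant_sign:
  fixes f :: "real \<Rightarrow> real"
  assumes "continuous_on {l<..<r} f" "\<And>x. x \<in> {l<..<r} \<Longrightarrow> f x \<noteq> 0"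
  shows "\<exists>\<sigma>\<in>{1, -1}. \<forall>x\<in>{l<..<r}. 0 \<le> \<sigma> * f x"
proof -
  have conn: "connected (f ` {l<..<r})"
    by (rule connected_continuous_image[OF assms(1)]) (rule connected_Ioo)
  have neg: "f y < 0" if x: "x \<in> {l<..<r}" "f x < 0" and y: "y \<in> {l<..<r}" for x y
  proof (rule ccontr)
    assume y0: "\<not> f y < 0"
    have "0 \<in> f ` {l<..<r}"
      by (rule connectedD_interval[OF conn imageI[OF x(1)] imageI[OF y], of 0]) (use x(2) y0 in linarith)+
    then obtain z where "0 = f z" "z \<in> {l<..<r}" by (rule imageE)
    then show False using assms(2)[of z] by simp
  qed
  show ?thesis
  proof (cases "\<exists>x\<in>{l<..<r}. f x < 0")
    case True
    then obtain x where x: "x \<in> {l<..<r}" "f x < 0" by (rule bexE)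
    have "\<forall>y\<in>{l<..<r}. 0 \<le> -1 * f y"
    proof
      fix y assume "y \<in> {l<..<r}"
      from neg[OF x this] show "0 \<le> -1 * f y" by simp
    qed
    then show ?thesis by (rule bexI[of _ "-1"]) simp
  next
    case False
    have "\<forall>y\<in>{l<..<r}. 0 \<le> 1 * f y"
    proof
      fix y assume "y \<in> {l<..<r}"
      then have "\<not> f y < 0" using False by blast
      then show "0 \<le> 1 * f y" by simp
    qed
    then show ?thesis by (rule bexI[of _ "1"]) simp
  qed
qed

text \<open>\<open>Y\<close> collects the zeros at which \<open>f\<close> changes sign, and the
  factors \<open>x - y\<close> undo these changes. Zeros are added from left to right;
  \<open>\<sigma>\<close> is the sign of the product to the left of the newest one.\<close>

lemma sign_change_set:
  fixes f :: "real \<Rightarrow> real"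
  assumes "finite Z" "Z \<subseteq> {l<..<r}" "continuous_on {l<..<r} f" "\<And>x. x \<in> {l<..<r} - Z \<Longrightarrow> f x \<noteq> 0"
  shows "\<exists>Y\<subseteq>Z. \<exists>\<sigma>\<in>{1, -1}. \<forall>x\<in>{l<..<r} - Z. 0 \<le> \<sigma> * (f x * (\<Prod>y\<in>Y. x - y))"
  using assms
proof (induction Z arbitrary: r rule: finite_linorder_max_induct)
  case empty
  have "\<exists>\<sigma>\<in>{1, -1}. \<forall>x\<in>{l<..<r}. 0 \<le> \<sigma> * f x"
    by (rule constant_sign) (use empty in \<open>simp_all\<close>)
  then show ?case by (intro exI[of _ "{}"]) simp
next
  case (insert z Z)
  have z: "l < z" "z < r" using insert.prems by auto
  have "continuous_on {l<..<z} f" using z by (intro continuous_on_subset[OF insert.prems(2)]) auto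
  moreover have "Z \<subseteq> {l<..<z}" using insert by auto
  moreover have "f x \<noteq> 0" if "x \<in> {l<..<z} - Z" for x using insert.prems(3)[of x] that z by auto
  ultimately obtain Y \<sigma> where Y: "Y \<subseteq> Z" and \<sigma>: "\<sigma> \<in> {1, -1}"
    and left: "\<And>x. x \<in> {l<..<z} - Z \<Longrightarrow> 0 \<le> \<sigma> * (f x * (\<Prod>y\<in>Y. x - y))"
    using insert.IH[of z] by blast
  have finY: "finite Y" "z \<notin> Y" using Y insert.hyps finite_subset by auto
  have "continuous_on {z<..<r} f" using z by (intro continuous_on_subset[OF insert.prems(2)]) auto
  moreover have "f x \<noteq> 0" if "x \<in> {z<..<r}" for x
  proof -
    have "x \<notin> Z" using insert.hyps(2) that by force
    then show ?thesis using insert.prems(3)[of x] that z by auto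
  qed
  ultimately obtain \<tau> where \<tau>: "\<tau> \<in> {1, -1}" "\<forall>x\<in>{z<..<r}. 0 \<le> \<tau> * f x"
    using constant_sign by blast
  have prodpos: "(\<Prod>y\<in>Y. x - y) \<ge> 0" if "x > z" for x
    using that Y insert.hyps(2) by (intro prod_nonneg) (auto intro: less_imp_le order.strict_trans)
  have right: "0 \<le> \<tau> * (f x * (\<Prod>y\<in>Y. x - y))" if "x \<in> {z<..<r}" for x
    using mult_nonneg_nonneg[of "\<tau> * f x" "\<Prod>y\<in>Y. x - y"] \<tau>(2) that prodpos[of x] by (simp add: mult.assoc)
  show ?case
  \<comment> \<open>Right of \<open>z\<close> the product over \<open>Y\<close> is nonnegative, so
    the sign there is \<open>\<tau>\<close>. If it differs from \<open>\<sigma>\<close>, the extra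
    factor \<open>x - z\<close> reverses the left side and the overall sign becomes
    \<open>\<tau>\<close>.\<close>
  proof (cases "\<tau> = \<sigma>")
    case True
    have "0 \<le> \<sigma> * (f x * (\<Prod>y\<in>Y. x - y))" if "x \<in> {l<..<r} - insert z Z" for x
      using left[of x] right[of x] that True by (cases "x < z") auto
    then show ?thesis using Y \<sigma> by blast
  next
    case False
    then have \<tau>\<sigma>: "\<tau> = - \<sigma>" using \<sigma> \<tau>(1) by auto
    have "0 \<le> \<tau> * (f x * (\<Prod>y\<in>insert z Y. x - y))" if x: "x \<in> {l<..<r} - insert z Z" for x
    proof -
      have "\<tau> * (f x * (\<Prod>y\<in>insert z Y. x - y)) = \<tau> * (f x * (\<Prod>y\<in>Y. x - y)) * (x - z)"
        using finY by simp
      moreover have "0 \<le> \<tau> * (f x * (\<Prod>y\<in>Y. x - y)) * (x - z)"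
      proof (cases "x < z")
        case True
        then show ?thesis using left[of x] x \<tau>\<sigma> by (intro mult_nonpos_nonpos) auto
      next
        case False
        then show ?thesis using right[of x] x by (intro mult_nonneg_nonneg[of "_ * (_ * _)"]) auto
      qed
      ultimately show ?thesis by (simp only:)
    qed
    moreover have "insert z Y \<subseteq> insert z Z" using Y by auto
    ultimately show ?thesis using \<tau>(1) by blast
  qed
qed

lemma coeff_prod_linear:
  fixes Y :: "real set"
  assumes "finite Y"
  shows "degree (\<Prod>y\<in>Y. [:-y, 1:]) = card Y" "coeff (\<Prod>y\<in>Y. [:-y, 1:]) (card Y) = 1"
proof -
  show 1: "degree (\<Prod>y\<in>Y. [:-y, 1:]) = card Y" by (subst degree_prod_eq_sum_degree) auto
  have "lead_coeff (\<Prod>y\<in>Y. [:-y, 1:]) = 1" by (subst lead_coeff_prod) auto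
  then show "coeff (\<Prod>y\<in>Y. [:-y, 1:]) (card Y) = 1" using 1 by simp
qed

text \<open>The hypothesis \<open>int\<close> packs orthogonality to lower degrees and the
  normalisation into one functional, the \<open>k\<close>-th coefficient. Orthogonality uses up all
  \<open>k\<close> possible positive zeros inside (0, 1); the normalisation fixes the sign at
  1.\<close>

lemma powr_sum_pos_at_1:
  fixes q s :: "nat \<Rightarrow> real" and \<gamma> :: real and k :: nat
  defines "f \<equiv> (\<lambda>x. \<Sum>i\<le>k. q i * x powr s i)"
  assumes inj: "inj_on s {..k}"
    and int: "\<And>P. degree P \<le> k \<Longrightarrow>
      ((\<lambda>x. f x * (1 - x) powr \<gamma> * poly P x) has_integral coeff P k) {0..1}"
  shows "(\<Sum>i\<le>k. q i) > 0"
proof -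
  have "\<exists>i\<le>k. q i \<noteq> 0"
  proof (rule ccontr)
    assume "\<not> ?thesis"
    then have "f = (\<lambda>x. 0)" by (auto simp: f_def)
    moreover have "((\<lambda>x. f x * (1 - x) powr \<gamma> * poly (monom 1 k) x) has_integral 1) {0..1}"
      using int[of "monom 1 k"] by (simp add: degree_monom_eq)
    ultimately have "((\<lambda>x. 0::real) has_integral 1) {0..1::real}" by simp
    from has_integral_unique[OF this has_integral_0] show False by simp
  qed
  then obtain i where i: "i \<in> {..k}" "q i \<noteq> 0" by auto
  define Z where "Z = {x. 0 < x \<and> x < 1 \<and> f x = 0}"
  have finZ: "finite Z"
    by (rule finite_subset[OF _ finite_powr_sum_zeros[of "{..k}" s i q]]) (use inj i in \<open>auto simp: Z_def f_def\<close>)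
  have zeros: "card W \<le> k" if "finite W" "W \<subseteq> {0<..}" "\<And>x. x \<in> W \<Longrightarrow> f x = 0" for W
    using powr_sum_zeros[of "{..k}" s i q W] inj i that by (auto simp: f_def)
  have contf: "continuous_on {0<..} f" unfolding f_def by (intro continuous_intros) auto
  obtain Y \<sigma> where Y: "Y \<subseteq> Z" and \<sigma>: "\<sigma> \<in> {1, -1}"
    and sign: "\<And>x. x \<in> {0<..<1} - Z \<Longrightarrow> 0 \<le> \<sigma> * (f x * (\<Prod>y\<in>Y. x - y))"
  proof -
    have "\<exists>Y\<subseteq>Z. \<exists>\<sigma>\<in>{1, -1}. \<forall>x\<in>{0<..<1} - Z. 0 \<le> \<sigma> * (f x * (\<Prod>y\<in>Y. x - y))"
      by (rule sign_change_set[OF finZ])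
        (auto simp: Z_def intro: continuous_on_subset[OF contf])
    then show ?thesis using that by blast
  qed
  have finY: "finite Y" using Y finZ finite_subset by blast
  \<comment> \<open>The test polynomial has the sign changes as its simple zeros, so
    \<open>f * P\<close> has constant weak sign on (0, 1).\<close>
  define P where "P = (\<Prod>y\<in>Y. [:-y, 1:])"
  have polyP: "poly P x = (\<Prod>y\<in>Y. x - y)" for x by (simp add: P_def poly_prod)
  define g where "g x = \<sigma> * (f x * (1 - x) powr \<gamma> * poly P x)" for x
  have sign': "0 \<le> \<sigma> * (f x * poly P x)" if "x \<in> {0<..<1}" for x
    using sign[of x] that by (cases "x \<in> Z") (auto simp: Z_def polyP)
  have g0: "0 \<le> g x" if "x \<in> {0<..<1}" for x
    using mult_nonneg_nonneg[OF sign'[OF that], of "(1 - x) powr \<gamma>"] by (simp add: g_def mult_ac)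
  have cardY: "card Y \<le> k"
    by (rule zeros) (use Y finY in \<open>auto simp: Z_def\<close>)
  have degP: "degree P \<le> k" using cardY coeff_prod_linear[OF finY] by (simp add: P_def)
  have intg: "(g has_integral (\<sigma> * coeff P k)) {0<..<1}"
    unfolding g_def has_integral_Icc_iff_Ioo[symmetric] by (rule has_integral_mult_right[OF int[OF degP]])
  have "card Y = k"
  proof (rule ccontr)
    assume "card Y \<noteq> k"
    then have "coeff P k = 0"
      using cardY coeff_prod_linear[OF finY] by (intro coeff_eq_0) (simp add: P_def)
    then have int0: "(g has_integral 0) {0<..<1}" using intg by simp
    \<comment> \<open>Any closed interval inside (0, 1) serves; it avoids the endpoints, where the
      powers may be singular. The nonnegative continuous \<open>g\<close> with zero integral
      vanishes on it, which contradicts the finiteness of \<open>Z\<close>.\<close>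
    define a b :: real where "a = 1 / 3" and "b = 2 / 3"
    have ab: "0 < a" "a < b" "b < 1" by (simp_all add: a_def b_def)
    have contg: "continuous_on {a..b} g" unfolding g_def using ab
      by (intro continuous_intros continuous_on_subset[OF contf]) auto
    have "integral {a..b} g \<le> integral {0<..<1} g"
      using ab int0 g0 integrable_continuous_interval[OF contg] by (intro integral_subset_le) auto
    also have "\<dots> = 0" using int0 by (rule integral_unique)
    finally have "integral {a..b} g \<le> 0" .
    moreover have "integral {a..b} g \<ge> 0" using ab g0 by (intro integral_nonneg integrable_continuous_interval contg) auto
    ultimately have "(g has_integral 0) (cbox a b)"
      using integrable_integral[OF integrable_continuous_interval[OF contg]] by simp
    then have gz: "g x = 0" if "x \<in> {a..b}" for x
      using has_integral_0_cbox_imp_0[of a b g x] contg g0 ab that by auto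
    have "{a..b} \<subseteq> Z"
    proof
      fix x assume x: "x \<in> {a..b}"
      then have "f x = 0 \<or> poly P x = 0" using gz[OF x] \<sigma> ab by (auto simp: g_def)
      then show "x \<in> Z"
      proof
        assume "poly P x = 0"
        then have "x \<in> Y" using finY by (auto simp: polyP)
        then show ?thesis using Y by auto
      qed (use x ab in \<open>auto simp: Z_def\<close>)
    qed
    then show False using finZ ab finite_subset infinite_Icc[of a b] by blast
  qed
  \<comment> \<open>\<open>P\<close> is monic of degree \<open>k\<close>, so the integral of the
    nonnegative \<open>g\<close> is \<open>\<sigma>\<close> itself, which excludes -1.\<close>
  then have "coeff P k = 1" using coeff_prod_linear[OF finY] by (simp add: P_def)
  then have "0 \<le> \<sigma>" using has_integral_nonneg[OF intg] g0 by auto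
  then have \<sigma>1: "\<sigma> = 1" using \<sigma> by auto
  \<comment> \<open>Otherwise 1 together with \<open>Y\<close> would give \<open>k + 1\<close>
    positive zeros.\<close>
  have "f 1 \<noteq> 0"
  proof
    assume "f 1 = 0"
    then have "card (insert 1 Y) \<le> k" by (intro zeros) (use Y finY in \<open>auto simp: Z_def\<close>)
    moreover have "1 \<notin> Y" using Y by (auto simp: Z_def)
    ultimately show False using \<open>card Y = k\<close> finY by simp
  qed
  \<comment> \<open>The sign passes to 1 from the left by continuity; the weight is left out here
    because it may be singular at 1.\<close>
  moreover have "0 \<le> f 1 * poly P 1"
  proof (rule tendsto_lowerbound)
    have "isCont (\<lambda>x. f x * poly P x) 1" unfolding f_def by (intro continuous_intros) auto
    then show "((\<lambda>x. f x * poly P x) \<longlongrightarrow> f 1 * poly P 1) (at_left 1)"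
      by (simp add: isCont_def filterlim_at_split)
    show "\<forall>\<^sub>F x in at_left 1. 0 \<le> f x * poly P x"
      using sign' \<sigma>1 eventually_at_left_real[of 0 "1::real"] by (auto elim!: eventually_mono)
  qed simp
  moreover have "poly P 1 > 0" unfolding polyP using Y by (intro prod_pos) (auto simp: Z_def)
  ultimately have "f 1 > 0" by (metis linorder_neqE_linordered_idom mult_neg_pos not_le)
  then show ?thesis by (simp add: f_def)
qed

subsection \<open>Monic bases and triangular systems\<close>

text \<open>Leading terms are stripped one at a time. The bound is put on coefficients so that
  \<open>N = 0\<close> means exactly the zero polynomial.\<close>

lemma monic_basis_expansion:
  fixes B :: "nat \<Rightarrow> real poly"
  assumes B: "\<And>j. j < N \<Longrightarrow> degree (B j) = j \<and> lead_coeff (B j) = 1"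
    and P: "\<And>i. i \<ge> N \<Longrightarrow> coeff P i = 0"
  obtains r where "P = (\<Sum>j<N. smult (r j) (B j))"
  using assms
proof (induction N arbitrary: P thesis)
  case 0
  then show ?case by (simp add: poly_eq_iff)
next
  case (Suc N)
  define P' where "P' = P - smult (coeff P N) (B N)"
  have "coeff P' i = 0" if "i \<ge> N" for i
    using Suc.prems(2)[of N] Suc.prems(3)[of i] that
    by (cases "i = N") (auto simp: P'_def coeff_eq_0)
  then obtain r where r: "P' = (\<Sum>j<N. smult (r j) (B j))"
    using Suc.IH Suc.prems(2) by (metis less_Suc_eq)
  have "P = (\<Sum>j<Suc N. smult ((r(N := coeff P N)) j) (B j))"
    using r by (simp add: P'_def algebra_simps)
  then show ?case by (rule Suc.prems(1))
qed

text \<open>For the largest index \<open>m\<close> with \<open>r m \<noteq> 0\<close>, only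
  \<open>B m\<close> contributes to the coefficient of degree \<open>m\<close>. \<open>S\<close> is
  an arbitrary finite set because it will be the union of two row supports.\<close>

lemma monic_basis_independent:
  fixes B :: "nat \<Rightarrow> real poly"
  assumes B: "\<And>j. degree (B j) = j \<and> lead_coeff (B j) = 1"
    and "finite S" "(\<Sum>j\<in>S. smult (r j) (B j)) = 0" "j \<in> S"
  shows "r j = 0"
proof (rule ccontr)
  assume "r j \<noteq> 0"
  define T where "T = {j \<in> S. r j \<noteq> 0}"
  define m where "m = Max T"
  have fin: "finite T" using assms by (simp add: T_def)
  have m: "m \<in> T" unfolding m_def using fin \<open>r j \<noteq> 0\<close> assms by (intro Max_in) (auto simp: T_def)
  have "(\<Sum>j\<in>S. r j * coeff (B j) m) = 0"
    using arg_cong[OF assms(3), of "\<lambda>p. coeff p m"] by (simp add: coeff_sum)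
  moreover have "(\<Sum>j\<in>S. r j * coeff (B j) m) = (\<Sum>j\<in>{m}. r j * coeff (B j) m)"
  proof (rule sum.mono_neutral_right)
    show "\<forall>i\<in>S - {m}. r i * coeff (B i) m = 0"
    proof
      fix i assume i: "i \<in> S - {m}"
      show "r i * coeff (B i) m = 0"
      proof (cases "i \<in> T")
        case True
        then have "i < m" using i Max_ge[OF fin True] by (auto simp: m_def)
        then show ?thesis using B[of i] by (simp add: coeff_eq_0)
      qed (use i in \<open>auto simp: T_def\<close>)
    qed
  qed (use assms m in \<open>auto simp: T_def\<close>)
  ultimately show False using m B[of m] by (auto simp: T_def)
qed

text \<open>Both sides are linear and agree on a basis of the polynomials of degree at most
  \<open>k\<close>. It is applied to the step-line basis and to the monomials.\<close>

lemma linear_functional_coeff: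
  fixes B :: "nat \<Rightarrow> real poly" and L :: "real poly \<Rightarrow> real"
  assumes B: "\<And>j. j \<le> k \<Longrightarrow> degree (B j) = j \<and> lead_coeff (B j) = 1"
    and add: "\<And>P R. L (P + R) = L P + L R" and smult: "\<And>a P. L (smult a P) = a * L P"
    and L: "\<And>j. j \<le> k \<Longrightarrow> L (B j) = (if j = k then 1 else 0)"
    and P: "degree P \<le> k"
  shows "L P = coeff P k"
proof -
  have L0: "L 0 = 0" using smult[of 0 0] by simp
  obtain r where r: "P = (\<Sum>j<Suc k. smult (r j) (B j))"
  proof (rule monic_basis_expansion[of "Suc k" B P])
    show "degree (B j) = j \<and> lead_coeff (B j) = 1" if "j < Suc k" for j using that by (intro B) simp
    show "coeff P i = 0" if "i \<ge> Suc k" for i using P that by (simp add: coeff_eq_0)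
  qed
  have sum: "L (\<Sum>j\<in>S. f j) = (\<Sum>j\<in>S. L (f j))" if "finite S" for S :: "nat set" and f
    using that by (induction S) (auto simp: L0 add)
  have "L P = (\<Sum>j<Suc k. r j * L (B j))" unfolding r by (subst sum) (simp_all add: smult)
  also have "\<dots> = (\<Sum>j<Suc k. r j * coeff (B j) k)"
  proof (intro sum.cong refl)
    fix j assume "j \<in> {..<Suc k}"
    then show "r j * L (B j) = r j * coeff (B j) k" using B[of j] L[of j] by (auto simp: coeff_eq_0)
  qed
  also have "\<dots> = coeff P k" unfolding r by (simp add: coeff_sum)
  finally show ?thesis .
qed

text \<open>Back substitution: the last equation determines the last unknown, whose contribution
  moves to the right-hand sides of the others.\<close>

lemma upper_triangular_solvable:
  fixes M :: "nat \<Rightarrow> nat \<Rightarrow> real"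
  assumes "\<And>j. j < K \<Longrightarrow> M j j \<noteq> 0" "\<And>i j. i < j \<Longrightarrow> j < K \<Longrightarrow> M j i = 0"
  shows "\<exists>q. \<forall>j<K. (\<Sum>i<K. q i * M j i) = t j"
  using assms
proof (induction K arbitrary: t)
  case (Suc K)
  define x where "x = t K / M K K"
  obtain q where q: "\<And>j. j < K \<Longrightarrow> (\<Sum>i<K. q i * M j i) = t j - x * M j K"
    using Suc.IH[of "\<lambda>j. t j - x * M j K"] Suc.prems by auto
  have "(\<Sum>i<Suc K. (q(K := x)) i * M j i) = t j" if "j < Suc K" for j
    using that q[of j] Suc.prems by (cases "j = K") (auto simp: x_def)
  then show ?case by blast
qed simp

lemma upper_triangular_unique:
  fixes M :: "nat \<Rightarrow> nat \<Rightarrow> real"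
  assumes "\<And>j. j < K \<Longrightarrow> M j j \<noteq> 0" "\<And>i j. i < j \<Longrightarrow> j < K \<Longrightarrow> M j i = 0"
    and "\<And>j. j < K \<Longrightarrow> (\<Sum>i<K. q i * M j i) = (\<Sum>i<K. q' i * M j i)" "i < K"
  shows "q i = q' i"
  using assms
proof (induction K arbitrary: i)
  case (Suc K)
  have "(\<Sum>i<K. q i * M K i) = 0" "(\<Sum>i<K. q' i * M K i) = 0"
    using Suc.prems(2)[of _ K] by auto
  then have K: "q K = q' K" using Suc.prems(1,3)[of K] by simp
  moreover have "q i = q' i" if "i < K"
    using Suc.IH[OF _ _ _ that] Suc.prems(1-3) K by simp
  ultimately show ?case using Suc.prems(4) by (auto simp: less_Suc_eq)
qed simp

lemma poly_eq_sum_lessThan: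
  fixes p :: "real poly"
  assumes "\<And>j. j \<ge> n \<Longrightarrow> coeff p j = 0"
  shows "poly p x = (\<Sum>j<n. coeff p j * x ^ j)"
proof -
  have "poly p x = (\<Sum>j\<le>degree p. coeff p j * x ^ j)" by (rule poly_altdef)
  also have "\<dots> = (\<Sum>j<max n (Suc (degree p)). coeff p j * x ^ j)"
    by (intro sum.mono_neutral_left) (auto simp: coeff_eq_0)
  also have "\<dots> = (\<Sum>j<n. coeff p j * x ^ j)"
    using assms by (intro sum.mono_neutral_right) auto
  finally show ?thesis .
qed

lemma sum_even_odd:
  fixes f :: "nat \<Rightarrow> real"
  shows "(\<Sum>i<N. f i) = (\<Sum>j<Suc N div 2. f (2 * j)) + (\<Sum>j<N div 2. f (2 * j + 1))"
proof (induction N)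
  case (Suc N)
  then show ?case
  proof (cases "even N")
    case True
    then obtain a where a: "N = 2 * a" by (rule evenE)
    show ?thesis using Suc unfolding a by simp
  next
    case False
    then obtain a where a: "N = 2 * a + 1" by (rule oddE)
    show ?thesis using Suc unfolding a by simp
  qed
qed simp

lemma powr_mult_power:
  fixes x :: real
  assumes "x \<ge> 0" shows "x ^ j * x powr a = x powr (a + j)"
  \<comment> \<open>At \<open>x = 0\<close> both sides are 0, because \<open>0 powr a = 0\<close>
    for every \<open>a\<close>.\<close>
  using assms by (cases "x = 0") (auto simp: powr_add powr_realpow)

lemma node_even: "node \<alpha> \<beta> (2 * j) = \<alpha> + j" and node_odd: "node \<alpha> \<beta> (2 * j + 1) = \<beta> + j"
  by (auto simp: node_def)

subsection \<open>Step-line polynomials\<close>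

text \<open>The polynomials are built from the recurrence, and orthogonality follows later from
  their Mellin transforms. In the instance used below \<open>c 0\<close>, \<open>d 0\<close> and
  \<open>d 1\<close> are zero, so the truncated indices contribute nothing.\<close>

fun recurrence_poly :: "(nat \<Rightarrow> real) \<Rightarrow> (nat \<Rightarrow> real) \<Rightarrow> (nat \<Rightarrow> real) \<Rightarrow> nat \<Rightarrow> real poly" where
  "recurrence_poly b c d 0 = 1"
| "recurrence_poly b c d (Suc N) = pCons 0 (recurrence_poly b c d N) -
     (smult (b N) (recurrence_poly b c d N) + smult (c N) (recurrence_poly b c d (N - 1)) +
      smult (d N) (recurrence_poly b c d (N - 2)))"

lemma recurrence_poly_monic:
  "degree (recurrence_poly b c d N) = N \<and> lead_coeff (recurrence_poly b c d N) = 1"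
proof (induction N rule: less_induct)
  case (less N)
  show ?case
  proof (cases N)
    case (Suc M)
    let ?r = "recurrence_poly b c d"
    define R where "R = smult (b M) (?r M) + smult (c M) (?r (M - 1)) + smult (d M) (?r (M - 2))"
    have rN: "?r N = pCons 0 (?r M) - R" by (simp add: R_def Suc)
    have "degree (?r M) \<le> M" "degree (?r (M - 1)) \<le> M" "degree (?r (M - 2)) \<le> M"
      using less[of M] less[of "M - 1"] less[of "M - 2"] Suc by auto
    then have R: "degree R \<le> M"
      unfolding R_def by (intro degree_add_le order_trans[OF degree_smult_le])
    have "?r M \<noteq> 0" using less[of M] Suc by auto
    then have X: "degree (pCons 0 (?r M)) = Suc M" using less[of M] Suc by simp
    then have "degree (?r N) = Suc M" using R
      degree_add_eq_left[of "- R" "pCons 0 (?r M)"] by (simp add: rN)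
    moreover have "coeff (?r N) (Suc M) = 1"
      unfolding rN using R less[of M] Suc coeff_eq_0[of R "Suc M"] by auto
    ultimately show ?thesis using Suc by simp
  qed simp
qed

section \<open>Moments of the weight and Mellin transforms\<close>

locale jacobi_pineiro =
  fixes \<alpha> \<beta> \<gamma> :: real
  assumes alpha: "\<alpha> > -1" and beta: "\<beta> > -1" and gamma: "\<gamma> > -1"
    and distinct: "\<alpha> \<noteq> \<beta>" and close: "\<bar>\<alpha> - \<beta>\<bar> < 1"
begin

abbreviation "nd \<equiv> node \<alpha> \<beta>"

lemma nd_gt: "nd i > -1" using alpha beta by (auto simp: node_def)

text \<open>Equal nodes of different parity would make \<alpha> - \<beta> an integer, nonzero by
  distinctness but of modulus less than 1.\<close>

lemma inj_nd: "inj nd"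
proof (rule injI)
  fix i j assume eq: "nd i = nd j"
  have 1: "\<alpha> + real (m::nat) \<noteq> \<beta> + real n" for m n
  proof
    assume "\<alpha> + real m = \<beta> + real n"
    then have "\<bar>real_of_int (int m - int n)\<bar> < 1" "int m - int n \<noteq> 0" using distinct close by auto
    then show False by linarith
  qed
  show "i = j"
  proof (cases "even i \<longleftrightarrow> even j")
    case True
    then have "i div 2 = j div 2" using eq by (auto simp: node_def)
    then show ?thesis using True by (metis div_mod_decomp even_iff_mod_2_eq_zero odd_iff_mod_2_eq_one)
  next
    case False
    then show ?thesis using eq 1[of "i div 2" "j div 2"] 1[of "j div 2" "i div 2"] by (auto simp: node_def)
  qed
qed

text \<open>For \<open>s > -1\<close> this is the integral of
  \<open>x powr s * (1 - x) powr \<gamma>\<close> over the unit interval.\<close>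

definition moment :: "real \<Rightarrow> real" where
  "moment s = Beta (s + 1) (\<gamma> + 1)"

lemma moment_pos: "s > -1 \<Longrightarrow> moment s > 0"
  unfolding moment_def Beta_def using gamma by (auto intro!: divide_pos_pos mult_pos_pos)

lemma moment_plus1:
  assumes "s > -1" shows "moment (s + 1) * (s + \<gamma> + 2) = moment s * (s + 1)"
proof -
  have "s + 1 \<notin> \<int>\<^sub>\<le>\<^sub>0" using assms by (auto elim!: nonpos_Ints_cases')
  then show ?thesis using Beta_plus1_left[of "s + 1" "\<gamma> + 1"] by (simp add: moment_def algebra_simps)
qed

text \<open>The Mellin transform of \<open>P\<close> times the weight, as a finite sum of moments:
  linearity and the shift rule then hold for every \<open>s\<close> without convergence conditions.
  For \<open>s > -1\<close>, \<open>has_integral_moment_pairing\<close> identifies it with the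
  integral.\<close>

definition moment_pairing :: "real poly \<Rightarrow> real \<Rightarrow> real" where
  "moment_pairing P s = (\<Sum>k\<le>degree P. coeff P k * moment (s + k))"

lemma moment_pairing_eq:
  "degree P \<le> n \<Longrightarrow> moment_pairing P s = (\<Sum>k\<le>n. coeff P k * moment (s + k))"
  unfolding moment_pairing_def by (intro sum.mono_neutral_left) (auto simp: coeff_eq_0)

lemma moment_pairing_0 [simp]: "moment_pairing 0 s = 0"
  by (simp add: moment_pairing_def)

lemma moment_pairing_add: "moment_pairing (P + R) s = moment_pairing P s + moment_pairing R s"
proof -
  define n where "n = max (degree P) (degree R)"
  have "degree P \<le> n" "degree R \<le> n" "degree (P + R) \<le> n"
    by (auto simp: n_def intro: degree_add_le)
  then show ?thesis by (simp add: moment_pairing_eq[of _ n] algebra_simps sum.distrib)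
qed

lemma moment_pairing_smult: "moment_pairing (smult a P) s = a * moment_pairing P s"
  by (simp add: moment_pairing_eq[of _ "degree P"] sum_distrib_left mult.assoc)

lemma moment_pairing_diff: "moment_pairing (P - R) s = moment_pairing P s - moment_pairing R s"
  using moment_pairing_add[of P "smult (-1) R" s] moment_pairing_smult[of "-1" R s] by simp

lemma moment_pairing_sum: "moment_pairing (\<Sum>j\<in>S. f j) s = (\<Sum>j\<in>S. moment_pairing (f j) s)"
  by (induction S rule: infinite_finite_induct) (auto simp: moment_pairing_add)

lemma moment_pairing_pCons: "moment_pairing (pCons 0 P) s = moment_pairing P (s + 1)"
proof -
  have "moment_pairing (pCons 0 P) s = (\<Sum>k\<le>Suc (degree P). coeff (pCons 0 P) k * moment (s + k))"
    by (intro moment_pairing_eq degree_pCons_le)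
  also have "\<dots> = moment_pairing P (s + 1)"
    unfolding moment_pairing_def sum.atMost_Suc_shift by (simp add: add_ac)
  finally show ?thesis .
qed

lemma moment_pairing_1: "moment_pairing 1 s = moment s"
  by (simp add: moment_pairing_def)

lemma has_integral_moment_pairing:
  assumes "s > -1"
  shows "((\<lambda>x. poly P x * x powr s * (1 - x) powr \<gamma>) has_integral moment_pairing P s) {0..1}"
proof -
  have "((\<lambda>x. \<Sum>k\<le>degree P. coeff P k * (x powr ((s + k + 1) - 1) * (1 - x) powr ((\<gamma> + 1) - 1)))
      has_integral moment_pairing P s) {0..1}"
    unfolding moment_pairing_def moment_def using assms gamma
    by (intro has_integral_sum has_integral_mult_right has_integral_Beta_real) auto
  moreover have "(\<Sum>k\<le>degree P. coeff P k * (x powr ((s + k + 1) - 1) * (1 - x) powr ((\<gamma> + 1) - 1)))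
      = poly P x * x powr s * (1 - x) powr \<gamma>" if "x \<in> {0..1}" for x
    unfolding poly_altdef sum_distrib_right
  proof (intro sum.cong refl)
    fix k
    show "coeff P k * (x powr ((s + k + 1) - 1) * (1 - x) powr ((\<gamma> + 1) - 1)) =
      coeff P k * x ^ k * x powr s * (1 - x) powr \<gamma>"
      using that by (cases "x = 0") (auto simp: powr_add powr_realpow)
  qed
  ultimately show ?thesis by (rule has_integral_eq[rotated])
qed

lemma recurrence_coefficients:
  obtains c3 c2 c1 c0 :: "nat \<Rightarrow> real" where
    "\<And>N. c3 N > 0" "\<And>N. c2 N \<ge> 0" "\<And>N. c1 N \<ge> 0" "\<And>N. c0 N \<ge> 0"
    "c1 0 = 0" "\<And>N. N < 2 \<Longrightarrow> c0 N = 0"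
    "\<And>N s. (s + 1) * node_prod \<alpha> \<beta> N (s + 1) =
        c3 N * node_prod \<alpha> \<beta> (Suc N) s + c2 N * (node_prod \<alpha> \<beta> N s * (s + \<gamma> + N + 2)) +
        c1 N * (node_prod \<alpha> \<beta> (N - 1) s * ((s + \<gamma> + N + 1) * (s + \<gamma> + N + 2))) +
        c0 N * (node_prod \<alpha> \<beta> (N - 2) s * ((s + \<gamma> + N) * (s + \<gamma> + N + 1) * (s + \<gamma> + N + 2)))"
  using node_prod_recurrence[OF alpha beta gamma distinct close] by metis

text \<open>The Mellin formula propagates along the recurrence by strong induction. It contains the
  orthogonality, as zeros at the nodes, while the recurrence carries the nonnegative
  coefficients.\<close>

lemma step_line_polynomials:
  obtains B :: "nat \<Rightarrow> real poly" and b c d \<kappa> :: "nat \<Rightarrow> real" where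
    "\<And>N. degree (B N) = N \<and> lead_coeff (B N) = 1"
    "\<And>N. pCons 0 (B N) = B (Suc N) + smult (b N) (B N) + smult (c N) (B (N - 1)) + smult (d N) (B (N - 2))"
    "\<And>N. b N \<ge> 0" "\<And>N. c N \<ge> 0" "\<And>N. d N \<ge> 0"
    "\<And>N. \<kappa> N > 0"
    "\<And>N s. s > -1 \<Longrightarrow> moment_pairing (B N) s = \<kappa> N * moment s * node_prod \<alpha> \<beta> N s / pochhammer (s + \<gamma> + 2) N"
proof -
  obtain c3 c2 c1 c0 where pos: "\<And>N. c3 N > 0" "\<And>N. c2 N \<ge> 0" "\<And>N. c1 N \<ge> 0" "\<And>N. c0 N \<ge> 0"
    and zero: "c1 0 = 0" "\<And>N. N < 2 \<Longrightarrow> c0 N = 0"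
    and id: "\<And>N s. (s + 1) * node_prod \<alpha> \<beta> N (s + 1) =
        c3 N * node_prod \<alpha> \<beta> (Suc N) s + c2 N * (node_prod \<alpha> \<beta> N s * (s + \<gamma> + N + 2)) +
        c1 N * (node_prod \<alpha> \<beta> (N - 1) s * ((s + \<gamma> + N + 1) * (s + \<gamma> + N + 2))) +
        c0 N * (node_prod \<alpha> \<beta> (N - 2) s * ((s + \<gamma> + N) * (s + \<gamma> + N + 1) * (s + \<gamma> + N + 2)))"
    by (rule recurrence_coefficients) metis
  \<comment> \<open>Each step multiplies the Mellin constant by \<open>c3\<close>. The ratios of
    \<open>\<kappa>\<close> in \<open>c\<close> and \<open>d\<close> convert the coefficients of the
    node identity into those of monic polynomials.\<close>
  define \<kappa> where "\<kappa> N = (\<Prod>i<N. c3 i)" for N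
  have \<kappa>: "\<kappa> N > 0" for N using pos by (auto simp: \<kappa>_def intro: prod_pos)
  define c where "c N = c1 N * \<kappa> N / \<kappa> (N - 1)" for N
  define d where "d N = c0 N * \<kappa> N / \<kappa> (N - 2)" for N
  define B where "B = recurrence_poly c2 c d"
  have rec: "pCons 0 (B N) = B (Suc N) + smult (c2 N) (B N) + smult (c N) (B (N - 1)) + smult (d N) (B (N - 2))" for N
    by (simp add: B_def algebra_simps)
  have pair: "moment_pairing (B N) s = \<kappa> N * moment s * node_prod \<alpha> \<beta> N s / pochhammer (s + \<gamma> + 2) N"
    if "s > -1" for N s
    using that
  proof (induction N arbitrary: s rule: less_induct)
    case (less N)
    show ?case
    proof (cases N)
      case 0
      then show ?thesis by (simp add: B_def \<kappa>_def moment_pairing_1)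
    next
      case (Suc M)
      define y where "y = s + \<gamma> + 2"
      have y: "y > 0" using less.prems gamma by (simp add: y_def)
      define p where "p n = pochhammer y n" for n
      have p: "p n > 0" for n using y by (simp add: p_def pochhammer_pos)
      have pS: "p (Suc n) = p n * (y + n)" for n by (simp add: p_def pochhammer_Suc)
      define h where "h n = node_prod \<alpha> \<beta> n s" for n
      \<comment> \<open>The moment at \<open>s + 1\<close> supplies \<open>(s + 1) / y\<close>: the
        numerator completes the left side of the node identity, and
        \<open>y * pochhammer (y + 1) M\<close> is \<open>pochhammer y (Suc M)\<close>.\<close>
      have "moment_pairing (pCons 0 (B M)) s = \<kappa> M * moment (s + 1) * node_prod \<alpha> \<beta> M (s + 1) / pochhammer (y + 1) M"
        using less.IH[of M "s + 1"] less.prems Suc by (simp add: moment_pairing_pCons y_def add_ac)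
      also have "moment (s + 1) = moment s * (s + 1) / y"
        using moment_plus1[OF less.prems] y by (simp add: y_def divide_simps)
      also have "\<kappa> M * (moment s * (s + 1) / y) * node_prod \<alpha> \<beta> M (s + 1) / pochhammer (y + 1) M =
          \<kappa> M * moment s * ((s + 1) * node_prod \<alpha> \<beta> M (s + 1)) / p (Suc M)"
        by (simp add: p_def pochhammer_rec)
      also have "(s + 1) * node_prod \<alpha> \<beta> M (s + 1) =
          c3 M * h N + c2 M * (h M * (y + M)) + c1 M * (h (M - 1) * ((y + M - 1) * (y + M))) +
          c0 M * (h (M - 2) * ((y + M - 2) * (y + M - 1) * (y + M)))"
        unfolding id h_def y_def Suc by (simp add: algebra_simps)
      finally have 1: "moment_pairing (pCons 0 (B M)) s * p N = \<kappa> M * moment s * (c3 M * h N + c2 M * (h M * (y + M)) +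
          c1 M * (h (M - 1) * ((y + M - 1) * (y + M))) +
          c0 M * (h (M - 2) * ((y + M - 2) * (y + M - 1) * (y + M))))"
        using p[of N] Suc by simp
      have IH: "moment_pairing (B n) s * p n = \<kappa> n * moment s * h n" if "n < N" for n
        using less.IH[OF that less.prems] p[of n] by (simp add: p_def y_def h_def)
      have pN: "p N = p M * (y + M)" using Suc pS by simp
      \<comment> \<open>The lower terms of the recurrence are brought to the same denominator
        \<open>p N\<close>, where they match the last three terms of the node identity.\<close>
      have t2: "moment_pairing (smult (c2 M) (B M)) s * p N = \<kappa> M * moment s * (c2 M * (h M * (y + M)))"
      proof -
        have "moment_pairing (smult (c2 M) (B M)) s * p N = c2 M * (y + M) * (moment_pairing (B M) s * p M)"
          by (simp add: moment_pairing_smult pN)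
        then show ?thesis using IH[of M] Suc by simp
      qed
      have t1: "moment_pairing (smult (c M) (B (M - 1))) s * p N =
          \<kappa> M * moment s * (c1 M * (h (M - 1) * ((y + M - 1) * (y + M))))"
      proof (cases M)
        case 0
        then show ?thesis using zero by (simp add: c_def moment_pairing_smult)
      next
        case (Suc M')
        have "moment_pairing (smult (c M) (B (M - 1))) s * p N = c M * ((y + M') * (y + M)) * (moment_pairing (B M') s * p M')"
          using pN pS[of M'] Suc by (simp add: moment_pairing_smult)
        also have "\<dots> = c M * ((y + M') * (y + M)) * (\<kappa> M' * moment s * h M')"
          using IH[of M'] \<open>N = Suc M\<close> Suc by simp
        also have "\<dots> = (c M * \<kappa> M') * moment s * (h M' * ((y + M') * (y + M)))" by simp
        also have "c M * \<kappa> M' = c1 M * \<kappa> M" using \<kappa>[of M'] Suc by (simp add: c_def)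
        finally show ?thesis using Suc by (simp add: mult_ac)
      qed
      have t0: "moment_pairing (smult (d M) (B (M - 2))) s * p N =
          \<kappa> M * moment s * (c0 M * (h (M - 2) * ((y + M - 2) * (y + M - 1) * (y + M))))"
      proof (cases "M < 2")
        case True
        then show ?thesis using zero(2)[of M] by (simp add: d_def moment_pairing_smult)
      next
        case False
        then obtain M' where M': "M = Suc (Suc M')" by (metis Suc_1 less_2_cases_iff not0_implies_Suc One_nat_def)
        have "p N = p M' * ((y + M') * (y + Suc M') * (y + M))"
          using pN pS[of M'] pS[of "Suc M'"] M' by simp
        then have "moment_pairing (smult (d M) (B (M - 2))) s * p N =
            d M * ((y + M') * (y + Suc M') * (y + M)) * (moment_pairing (B M') s * p M')"
          using M' by (simp add: moment_pairing_smult)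
        also have "\<dots> = d M * ((y + M') * (y + Suc M') * (y + M)) * (\<kappa> M' * moment s * h M')"
          using IH[of M'] \<open>N = Suc M\<close> M' by simp
        also have "\<dots> = (d M * \<kappa> M') * moment s * (h M' * ((y + M') * (y + Suc M') * (y + M)))" by simp
        also have "d M * \<kappa> M' = c0 M * \<kappa> M" using \<kappa>[of M'] M' by (simp add: d_def)
        finally show ?thesis using M' by (simp add: mult_ac)
      qed
      \<comment> \<open>Subtracting the lower terms leaves the \<open>c3\<close> term alone, and
        \<open>\<kappa> M * c3 M = \<kappa> N\<close>.\<close>
      have "moment_pairing (B N) s * p N = moment_pairing (pCons 0 (B M)) s * p N
         - (moment_pairing (smult (c2 M) (B M)) s * p N + moment_pairing (smult (c M) (B (M - 1))) s * p N
            + moment_pairing (smult (d M) (B (M - 2))) s * p N)"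
        unfolding rec[of M] Suc by (simp add: moment_pairing_add algebra_simps)
      also have "\<dots> = \<kappa> M * moment s * (c3 M * h N)"
        unfolding 1 t0 t1 t2 by (simp only: ring_distribs)
      also have "\<dots> = \<kappa> N * moment s * h N" by (simp add: \<kappa>_def Suc)
      finally show ?thesis using p[of N] by (simp add: p_def y_def h_def field_simps)
    qed
  qed
  show ?thesis
  proof (rule that[of B c2 c d \<kappa>])
    show "degree (B N) = N \<and> lead_coeff (B N) = 1" for N
      unfolding B_def by (rule recurrence_poly_monic)
    show "c N \<ge> 0" for N using pos \<kappa> by (simp add: c_def less_imp_le)
    show "d N \<ge> 0" for N using pos \<kappa> by (simp add: d_def less_imp_le)
  qed (fact rec pos \<kappa> pair)+
qed

end

section \<open>Orthogonality and the triangular matrix of pairings\<close>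

locale step_line_system = jacobi_pineiro +
  fixes B :: "nat \<Rightarrow> real poly" and b c d \<kappa> :: "nat \<Rightarrow> real"
  assumes monic: "degree (B N) = N \<and> lead_coeff (B N) = 1"
    and recurrence: "pCons 0 (B N) =
      B (Suc N) + smult (b N) (B N) + smult (c N) (B (N - 1)) + smult (d N) (B (N - 2))"
    and nonneg: "b N \<ge> 0" "c N \<ge> 0" "d N \<ge> 0"
    and \<kappa>_pos: "\<kappa> N > 0"
    and pairing_B: "s > -1 \<Longrightarrow>
      moment_pairing (B N) s = \<kappa> N * moment s * node_prod \<alpha> \<beta> N s / pochhammer (s + \<gamma> + 2) N"
begin

text \<open>This matrix is upper triangular, since the node product of \<open>B j\<close> vanishes
  at earlier nodes, and its diagonal is nonzero, since the nodes are distinct. Uniqueness of the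
  polynomials and the construction of the type I forms rest on this.\<close>

definition pairing :: "nat \<Rightarrow> nat \<Rightarrow> real" where
  "pairing j i = moment_pairing (B j) (nd i)"

lemma pairing_eq_0: "i < j \<Longrightarrow> pairing j i = 0"
  using nd_gt[of i] by (auto simp: pairing_def pairing_B node_prod_def)

lemma pairing_diag: "pairing i i \<noteq> 0"
proof -
  have "pochhammer (nd i + \<gamma> + 2) i > 0" using nd_gt[of i] gamma by (intro pochhammer_pos) auto
  moreover have "node_prod \<alpha> \<beta> i (nd i) \<noteq> 0"
    by (auto simp: node_prod_def dest: injD[OF inj_nd])
  ultimately show ?thesis
    using nd_gt[of i] moment_pos[of "nd i"] \<kappa>_pos[of i] by (auto simp: pairing_def pairing_B)
qed

text \<open>In the step-line basis the condition at \<open>nd i\<close> involves only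
  \<open>r j\<close> with \<open>j \<le> i\<close>, so the coefficients vanish one after
  another.\<close>

lemma orthogonal_imp_0:
  assumes D: "\<And>i. i \<ge> N \<Longrightarrow> coeff D i = 0" and orth: "\<And>i. i < N \<Longrightarrow> moment_pairing D (nd i) = 0"
  shows "D = 0"
proof -
  obtain r where r: "D = (\<Sum>j<N. smult (r j) (B j))"
    using monic_basis_expansion[of N B D] monic D by blast
  have "r i = 0" if "i < N" for i
    using that
  proof (induction i rule: less_induct)
    case (less i)
    have "0 = (\<Sum>j<N. r j * pairing j i)"
      using orth[OF less.prems] by (simp add: r moment_pairing_sum moment_pairing_smult pairing_def)
    also have "\<dots> = (\<Sum>j\<in>{i}. r j * pairing j i)"
    proof (rule sum.mono_neutral_right)
      show "\<forall>j\<in>{..<N} - {i}. r j * pairing j i = 0"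
        using less.IH pairing_eq_0 by (auto simp: neq_iff)
    qed (use less.prems in auto)
    finally show ?case using pairing_diag[of i] by simp
  qed
  then show ?thesis by (simp add: r)
qed

text \<open>\<open>Suc N div 2\<close> and \<open>N div 2\<close> count the even and odd indices
  below \<open>N\<close>; they form the step-line multi-index of total size
  \<open>N\<close>.\<close>

lemma all_nodes_iff:
  "(\<forall>i<N. R (nd i)) \<longleftrightarrow> (\<forall>j<Suc N div 2. R (\<alpha> + real j)) \<and> (\<forall>j<N div 2. R (\<beta> + real j))"
proof safe
  fix j assume *: "\<forall>i<N. R (nd i)"
  show "R (\<alpha> + real j)" if "j < Suc N div 2" using *[rule_format, of "2 * j"] that by (simp add: node_even)
  show "R (\<beta> + real j)" if "j < N div 2"
    using *[rule_format, of "2 * j + 1"] that unfolding node_odd by simp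
next
  fix i assume *: "\<forall>j<Suc N div 2. R (\<alpha> + real j)" "\<forall>j<N div 2. R (\<beta> + real j)" "i < N"
  then show "R (nd i)"
  proof (cases "even i")
    case True
    then obtain j where j: "i = 2 * j" by (rule evenE)
    then have "j < Suc N div 2" using \<open>i < N\<close> by auto
    then show ?thesis using * unfolding j node_even by blast
  next
    case False
    then obtain j where j: "i = 2 * j + 1" by (rule oddE)
    then have "j < N div 2" using \<open>i < N\<close> by auto
    then show ?thesis using * unfolding j node_odd by blast
  qed
qed

text \<open>Existence is the vanishing of the Mellin transform at the first \<open>N\<close> nodes.
  For uniqueness, the leading terms of \<open>P - B N\<close> cancel and
  \<open>orthogonal_imp_0\<close> applies. This resolves the definite description in
  \<open>B_poly\<close>.\<close>

lemma is_typeII_iff: "is_typeII \<alpha> \<beta> \<gamma> (Suc N div 2) (N div 2) P \<longleftrightarrow> P = B N"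
proof -
  have int: "integral {0..1} (\<lambda>x. poly P x * x powr s * (1 - x) powr \<gamma>) = moment_pairing P s" if "s > -1" for P s
    using has_integral_moment_pairing[OF that] by (rule integral_unique)
  have "Suc N div 2 + N div 2 = N" by presburger
  then have iff: "is_typeII \<alpha> \<beta> \<gamma> (Suc N div 2) (N div 2) P \<longleftrightarrow>
      degree P = N \<and> lead_coeff P = 1 \<and> (\<forall>i<N. moment_pairing P (nd i) = 0)" for P
    unfolding is_typeII_def all_nodes_iff[of N "\<lambda>s. moment_pairing P s = 0"]
    using alpha beta by (simp add: int)
  show ?thesis
  proof
    assume P: "is_typeII \<alpha> \<beta> \<gamma> (Suc N div 2) (N div 2) P"
    have "P - B N = 0"
    proof (rule orthogonal_imp_0)
      show "moment_pairing (P - B N) (nd i) = 0" if "i < N" for i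
        using P that pairing_eq_0[OF that] by (simp add: iff moment_pairing_diff pairing_def)
      show "coeff (P - B N) i = 0" if "i \<ge> N" for i
        using P that monic[of N] by (cases "i = N") (auto simp: iff coeff_eq_0)
    qed
    then show "P = B N" by simp
  next
    assume "P = B N"
    then show "is_typeII \<alpha> \<beta> \<gamma> (Suc N div 2) (N div 2) P"
      using monic[of N] pairing_eq_0 unfolding iff by (auto simp: pairing_def)
  qed
qed

lemma B_step_eq: "B_step \<alpha> \<beta> \<gamma> N = B N"
proof -
  have "B_poly \<alpha> \<beta> \<gamma> (Suc N div 2) (N div 2) = B N" unfolding B_poly_def is_typeII_iff by simp
  then show ?thesis by (auto simp: B_step_def)
qed

text \<open>For \<open>k < 2\<close> the truncated subtractions only merge terms of the recurrence.\<close>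

definition J :: "nat \<Rightarrow> nat \<Rightarrow> real" where
  "J k l = (if l = Suc k then 1 else 0) + (if l = k then b k else 0) +
     (if l = k - 1 then c k else 0) + (if l = k - 2 then d k else 0)"

lemma J_nonneg: "J k l \<ge> 0"
  using nonneg by (simp add: J_def)

lemma J_Suc [simp]: "J k (Suc k) = 1"
proof -
  have "Suc k \<noteq> k - 1" "Suc k \<noteq> k - 2" by arith+
  then show ?thesis by (simp add: J_def)
qed

lemma J_eq_0: "l > Suc k \<or> l + 2 < k \<Longrightarrow> J k l = 0"
  by (auto simp: J_def)

lemma x_times_B: "pCons 0 (B k) = (\<Sum>l\<le>Suc k. smult (J k l) (B l))"
proof -
  have if_smult: "smult (if P then x else 0) p = (if P then smult x p else 0)" for P and x :: real and p
    by simp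
  have "(\<Sum>l\<le>Suc k. smult (J k l) (B l)) =
      (\<Sum>l\<le>Suc k. if l = Suc k then smult 1 (B l) else 0) + (\<Sum>l\<le>Suc k. if l = k then smult (b k) (B l) else 0) +
      (\<Sum>l\<le>Suc k. if l = k - 1 then smult (c k) (B l) else 0) + (\<Sum>l\<le>Suc k. if l = k - 2 then smult (d k) (B l) else 0)"
    unfolding J_def smult_add_left sum.distrib if_smult ..
  also have "\<dots> = B (Suc k) + smult (b k) (B k) + smult (c k) (B (k - 1)) + smult (d k) (B (k - 2))"
    by (subst (1 2 3 4) sum.delta) auto
  finally show ?thesis by (simp add: recurrence)
qed

text \<open>On the union of the row supports of two candidates, the difference of the expansions is
  a vanishing finite combination of the \<open>B l\<close>, hence trivial.\<close>

lemma jacobi_matrix_eq: "jacobi_matrix \<alpha> \<beta> \<gamma> = J"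
  unfolding jacobi_matrix_def B_step_eq
proof (rule the_equality)
  have fin: "finite {l. J k l \<noteq> 0}" for k
    by (rule finite_subset[of _ "{..Suc k}"]) (use J_eq_0[of k] in \<open>auto simp: not_le[symmetric]\<close>)
  have exp: "[:0, 1:] * B k = (\<Sum>l | J k l \<noteq> 0. smult (J k l) (B l))" for k
  proof -
    have "[:0, 1:] * B k = (\<Sum>l\<le>Suc k. smult (J k l) (B l))" by (simp add: x_times_B)
    also have "\<dots> = (\<Sum>l | J k l \<noteq> 0. smult (J k l) (B l))"
      using J_eq_0[of k] by (intro sum.mono_neutral_right) (auto simp: not_le[symmetric])
    finally show ?thesis .
  qed
  show "\<forall>k. finite {l. J k l \<noteq> 0} \<and> [:0, 1:] * B k = (\<Sum>l | J k l \<noteq> 0. smult (J k l) (B l))"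
    using fin exp by blast
  fix J' :: "nat \<Rightarrow> nat \<Rightarrow> real"
  assume J': "\<forall>k. finite {l. J' k l \<noteq> 0} \<and> [:0, 1:] * B k = (\<Sum>l | J' k l \<noteq> 0. smult (J' k l) (B l))"
  show "J' = J"
  proof (intro ext)
    fix k l
    define S where "S = {l. J k l \<noteq> 0} \<union> {l. J' k l \<noteq> 0}"
    have finS: "finite S" using fin J' by (simp add: S_def)
    have "(\<Sum>l | J k l \<noteq> 0. smult (J k l) (B l)) = (\<Sum>l\<in>S. smult (J k l) (B l))"
      by (intro sum.mono_neutral_left finS) (auto simp: S_def)
    moreover have "(\<Sum>l | J' k l \<noteq> 0. smult (J' k l) (B l)) = (\<Sum>l\<in>S. smult (J' k l) (B l))"
      by (intro sum.mono_neutral_left finS) (auto simp: S_def)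
    ultimately have "(\<Sum>l\<in>S. smult (J' k l - J k l) (B l)) = 0"
      using exp[of k] J'[rule_format, of k] by (simp add: smult_diff_left sum_subtractf)
    then have "J' k l - J k l = 0" if "l \<in> S"
      using monic_basis_independent[of B S "\<lambda>l. J' k l - J k l"] monic finS that by blast
    then show "J' k l = J k l" by (cases "l \<in> S") (auto simp: S_def)
  qed
qed

subsection \<open>Type I forms\<close>

text \<open>Coefficients of the \<open>k\<close>-th type I form in the powers
  \<open>x powr nd i\<close>, fixed by biorthogonality with the \<open>B j\<close>. Zeros beyond
  \<open>k\<close> let forms of different index be added over a common range.\<close>

definition dual_coeff :: "nat \<Rightarrow> nat \<Rightarrow> real" where
  "dual_coeff k = (SOME q. (\<forall>i>k. q i = 0) \<and> (\<forall>j\<le>k. (\<Sum>i\<le>k. q i * pairing j i) = (if j = k then 1 else 0)))"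

lemma dual_coeff:
  shows dual_coeff_eq_0: "i > k \<Longrightarrow> dual_coeff k i = 0"
    and dual_coeff_pairing: "(\<Sum>i\<le>k. dual_coeff k i * pairing j i) = (if j = k then 1 else 0)"
proof -
  obtain q where q: "\<forall>j<Suc k. (\<Sum>i<Suc k. q i * pairing j i) = (if j = k then 1 else 0)"
    using upper_triangular_solvable[of "Suc k" pairing "\<lambda>j. if j = k then 1 else 0"]
      pairing_diag pairing_eq_0 by blast
  define q' where "q' i = (if i > k then 0 else q i)" for i
  have "(\<Sum>i\<le>k. q' i * pairing j i) = (\<Sum>i<Suc k. q i * pairing j i)" for j
    by (intro sum.cong) (auto simp: q'_def lessThan_Suc_atMost)
  then have "(\<forall>i>k. q' i = 0) \<and> (\<forall>j\<le>k. (\<Sum>i\<le>k. q' i * pairing j i) = (if j = k then 1 else 0))"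
    using q by (auto simp: q'_def)
  then have "\<exists>q. (\<forall>i>k. q i = 0) \<and> (\<forall>j\<le>k. (\<Sum>i\<le>k. q i * pairing j i) = (if j = k then 1 else 0))"
    by (rule exI[of _ q'])
  then have *: "(\<forall>i>k. dual_coeff k i = 0) \<and>
      (\<forall>j\<le>k. (\<Sum>i\<le>k. dual_coeff k i * pairing j i) = (if j = k then 1 else 0))"
    unfolding dual_coeff_def by (rule someI_ex)
  show "dual_coeff k i = 0" if "i > k" using * that by blast
  show "(\<Sum>i\<le>k. dual_coeff k i * pairing j i) = (if j = k then 1 else 0)"
  proof (cases "j \<le> k")
    \<comment> \<open>For \<open>j > k\<close> all pairings in the sum lie below the
      diagonal.\<close>
    case False
    then show ?thesis by (auto simp: pairing_eq_0 intro!: sum.neutral)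
  qed (use * in blast)
qed

definition form_pairing :: "nat \<Rightarrow> (nat \<Rightarrow> real) \<Rightarrow> real poly \<Rightarrow> real" where
  "form_pairing k v P = (\<Sum>i\<le>k. v i * moment_pairing P (nd i))"

lemma form_pairing_linear:
  "form_pairing k v (P + R) = form_pairing k v P + form_pairing k v R"
  "form_pairing k v (smult a P) = a * form_pairing k v P"
  by (simp_all add: form_pairing_def moment_pairing_add moment_pairing_smult sum.distrib sum_distrib_left algebra_simps)

lemma has_integral_form_pairing:
  "((\<lambda>x. (\<Sum>i\<le>k. v i * x powr nd i) * (1 - x) powr \<gamma> * poly P x) has_integral form_pairing k v P) {0..1}"
proof -
  have "((\<lambda>x. \<Sum>i\<le>k. v i * (poly P x * x powr nd i * (1 - x) powr \<gamma>)) has_integral form_pairing k v P) {0..1}"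
    unfolding form_pairing_def
    by (intro has_integral_sum has_integral_mult_right has_integral_moment_pairing nd_gt) auto
  then show ?thesis by (simp add: sum_distrib_right sum_distrib_left mult_ac)
qed

text \<open>Biorthogonality with the \<open>B j\<close> becomes extraction of the
  \<open>k\<close>-th coefficient, which contains the type I conditions on monomials.\<close>

lemma form_pairing_dual:
  assumes "degree P \<le> k" shows "form_pairing k (dual_coeff k) P = coeff P k"
proof (rule linear_functional_coeff[OF _ _ _ _ assms])
  show "form_pairing k (dual_coeff k) (B j) = (if j = k then 1 else 0)" for j
    using dual_coeff_pairing[of k j] by (simp only: form_pairing_def pairing_def)
qed (rule monic form_pairing_linear)+

text \<open>Conversely, the monomial conditions determine the pairings with every
  \<open>B j\<close>, and the triangular system has only one solution.\<close>

lemma form_pairing_eq_dual: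
  assumes "\<And>j. j \<le> k \<Longrightarrow> form_pairing k v (monom 1 j) = (if j = k then 1 else 0)" "i \<le> k"
  shows "v i = dual_coeff k i"
proof (rule upper_triangular_unique[of "Suc k" pairing])
  fix j assume j: "j < Suc k"
  have "form_pairing k v (B j) = coeff (B j) k"
    by (rule linear_functional_coeff[of k "monom 1"])
      (use assms(1) monic[of j] j in \<open>auto simp: form_pairing_linear degree_monom_eq\<close>)
  also have "\<dots> = (if j = k then 1 else 0)" using monic[of j] j by (auto simp: coeff_eq_0)
  finally show "(\<Sum>i<Suc k. v i * pairing j i) = (\<Sum>i<Suc k. dual_coeff k i * pairing j i)"
    using dual_coeff_pairing[of k j] by (simp only: form_pairing_def pairing_def lessThan_Suc_atMost)
qed (use assms(2) pairing_diag pairing_eq_0 in auto)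

section \<open>Coefficient vectors of type I pairs\<close>

definition interleave :: "real poly \<times> real poly \<Rightarrow> nat \<Rightarrow> real" where
  "interleave A i = coeff (if even i then fst A else snd A) (i div 2)"

text \<open>The degree bounds for the step-line multi-index of total size \<open>k + 1\<close>;
  stated on coefficients, they also force a polynomial to vanish when its component of the
  multi-index is 0.\<close>

definition deg_bounded :: "nat \<Rightarrow> real poly \<times> real poly \<Rightarrow> bool" where
  "deg_bounded k A \<longleftrightarrow> (\<forall>j\<ge>Suc (Suc k) div 2. coeff (fst A) j = 0) \<and> (\<forall>j\<ge>Suc k div 2. coeff (snd A) j = 0)"

lemma linear_form_eq:
  assumes "deg_bounded k A" "x \<ge> 0"
  shows "linear_form \<alpha> \<beta> A x = (\<Sum>i\<le>k. interleave A i * x powr nd i)"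
proof -
  have "(\<Sum>i\<le>k. interleave A i * x powr nd i) =
     (\<Sum>j<Suc (Suc k) div 2. coeff (fst A) j * x powr (\<alpha> + j)) + (\<Sum>j<Suc k div 2. coeff (snd A) j * x powr (\<beta> + j))"
    unfolding lessThan_Suc_atMost[symmetric] sum_even_odd[where N = "Suc k"] node_even node_odd by (simp add: interleave_def)
  moreover have "poly (fst A) x * x powr \<alpha> = (\<Sum>j<Suc (Suc k) div 2. coeff (fst A) j * x powr (\<alpha> + j))"
    using assms(1) unfolding deg_bounded_def
    by (subst poly_eq_sum_lessThan) (auto simp: sum_distrib_right mult.assoc powr_mult_power[OF assms(2)])
  moreover have "poly (snd A) x * x powr \<beta> = (\<Sum>j<Suc k div 2. coeff (snd A) j * x powr (\<beta> + j))"
    using assms(1) unfolding deg_bounded_def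
    by (subst poly_eq_sum_lessThan) (auto simp: sum_distrib_right mult.assoc powr_mult_power[OF assms(2)])
  ultimately show ?thesis by (simp add: linear_form_def)
qed

lemma degree_bound_iff: "degree (p :: real poly) \<le> n - 1 \<and> (n = 0 \<longrightarrow> p = 0) \<longleftrightarrow> (\<forall>j\<ge>n. coeff p j = 0)"
proof (cases n)
  case 0
  have "p = 0 \<longleftrightarrow> (\<forall>j. coeff p j = 0)" by (simp add: poly_eq_iff)
  then show ?thesis using 0 by auto
next
  case (Suc m)
  have "degree p \<le> m \<longleftrightarrow> (\<forall>j\<ge>Suc m. coeff p j = 0)"
    by (auto simp: coeff_eq_0 Suc_le_eq intro: degree_le)
  then show ?thesis using Suc by simp
qed

lemma is_typeI_iff:
  "is_typeI \<alpha> \<beta> \<gamma> (Suc (Suc k) div 2) (Suc k div 2) A \<longleftrightarrow> deg_bounded k A \<and>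
     (\<forall>j\<le>k. form_pairing k (interleave A) (monom 1 j) = (if j = k then 1 else 0))"
proof -
  have nm: "Suc (Suc k) div 2 + Suc k div 2 = Suc k" by presburger
  have int: "integral {0..1} (\<lambda>x. linear_form \<alpha> \<beta> A x * (1 - x) powr \<gamma> * x ^ j) =
      form_pairing k (interleave A) (monom 1 j)" if "deg_bounded k A" for j
  proof (rule integral_unique, rule has_integral_eq)
    show "((\<lambda>x. (\<Sum>i\<le>k. interleave A i * x powr nd i) * (1 - x) powr \<gamma> * poly (monom 1 j) x)
        has_integral form_pairing k (interleave A) (monom 1 j)) {0..1}"
      by (rule has_integral_form_pairing)
  qed (use that in \<open>simp add: linear_form_eq poly_monom\<close>)
  \<comment> \<open>With total size \<open>k + 1\<close>, the condition
    \<open>j + 2 \<le> n + m\<close> reads \<open>j < k\<close>.\<close>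
  have "is_typeI \<alpha> \<beta> \<gamma> (Suc (Suc k) div 2) (Suc k div 2) A \<longleftrightarrow> deg_bounded k A \<and>
     (\<forall>j<k. integral {0..1} (\<lambda>x. linear_form \<alpha> \<beta> A x * (1 - x) powr \<gamma> * x ^ j) = 0) \<and>
     integral {0..1} (\<lambda>x. linear_form \<alpha> \<beta> A x * (1 - x) powr \<gamma> * x ^ k) = 1"
    unfolding is_typeI_def nm deg_bounded_def degree_bound_iff[symmetric] by (auto simp: less_eq_Suc_le)
  also have "\<dots> \<longleftrightarrow> deg_bounded k A \<and>
     (\<forall>j\<le>k. form_pairing k (interleave A) (monom 1 j) = (if j = k then 1 else 0))"
    by (auto simp: int le_less)
  finally show ?thesis .
qed

text \<open>Splitting \<open>dual_coeff k\<close> by parity gives a type I pair, and any other such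
  pair has the same interleaved coefficients. This resolves the definite description in
  \<open>Q_form\<close>.\<close>

lemma Q_form_eq:
  assumes "x \<ge> 0"
  shows "Q_form \<alpha> \<beta> \<gamma> (Suc (Suc k) div 2) (Suc k div 2) x = (\<Sum>i\<le>k. dual_coeff k i * x powr nd i)"
proof -
  define A where "A = (\<Sum>j<Suc (Suc k) div 2. monom (dual_coeff k (2 * j)) j,
    \<Sum>j<Suc k div 2. monom (dual_coeff k (2 * j + 1)) j)"
  have bounded: "deg_bounded k A"
    by (auto simp: deg_bounded_def A_def coeff_sum)
  have inter: "interleave A i = dual_coeff k i" if "i \<le> k" for i
  proof (cases "even i")
    case True
    then obtain j where j: "i = 2 * j" by (rule evenE)
    then have "j < Suc (Suc k) div 2" using that by auto
    then show ?thesis unfolding j by (simp add: interleave_def A_def coeff_sum)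
  next
    case False
    then obtain j where j: "i = 2 * j + 1" by (rule oddE)
    then have "j < Suc k div 2" using that by auto
    then show ?thesis unfolding j by (simp add: interleave_def A_def coeff_sum)
  qed
  then have "form_pairing k (interleave A) = form_pairing k (dual_coeff k)"
    by (intro ext) (simp add: form_pairing_def)
  then have "is_typeI \<alpha> \<beta> \<gamma> (Suc (Suc k) div 2) (Suc k div 2) A"
    unfolding is_typeI_iff using bounded by (simp add: form_pairing_dual degree_monom_eq)
  moreover have "A' = A" if "is_typeI \<alpha> \<beta> \<gamma> (Suc (Suc k) div 2) (Suc k div 2) A'" for A'
  proof -
    have bounded': "deg_bounded k A'" using that unfolding is_typeI_iff by (rule conjunct1)
    have inter': "interleave A' i = dual_coeff k i" if "i \<le> k" for i
    proof (rule form_pairing_eq_dual[OF _ that])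
      show "form_pairing k (interleave A') (monom 1 j) = (if j = k then 1 else 0)" if "j \<le> k" for j
        using \<open>is_typeI _ _ _ _ _ A'\<close> that unfolding is_typeI_iff by blast
    qed
    have "coeff (fst A') j = coeff (fst A) j" for j
    proof (cases "j < Suc (Suc k) div 2")
      case True
      then have "2 * j \<le> k" by auto
      then have "interleave A' (2 * j) = interleave A (2 * j)" using inter' inter by (simp only:)
      then show ?thesis by (simp add: interleave_def)
    qed (use bounded' bounded in \<open>simp add: deg_bounded_def\<close>)
    moreover have "coeff (snd A') j = coeff (snd A) j" for j
    proof (cases "j < Suc k div 2")
      case True
      then have "2 * j + 1 \<le> k" by auto
      then have "interleave A' (2 * j + 1) = interleave A (2 * j + 1)" using inter' inter by (simp only:)
      then show ?thesis by (simp add: interleave_def)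
    qed (use bounded' bounded in \<open>simp add: deg_bounded_def\<close>)
    ultimately show ?thesis by (simp add: prod_eq_iff poly_eq_iff)
  qed
  ultimately have "(THE A. is_typeI \<alpha> \<beta> \<gamma> (Suc (Suc k) div 2) (Suc k div 2) A) = A" by (rule the_equality)
  then show ?thesis unfolding Q_form_def using linear_form_eq[OF bounded assms] inter by simp
qed

subsection \<open>Values at one\<close>

text \<open>The value at 1 of the \<open>k\<close>-th type I form, as every real power of 1 is
  1.\<close>

definition Q1 :: "nat \<Rightarrow> real" where
  "Q1 k = (\<Sum>i\<le>k. dual_coeff k i)"

lemma Q_form_at_1:
  assumes "n + m = Suc k" "n = m \<or> n = Suc m"
  shows "Q_form \<alpha> \<beta> \<gamma> n m 1 = Q1 k"
proof -
  have "Suc k div 2 = m" "Suc (Suc k) div 2 = n"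
    unfolding assms(1)[symmetric] using assms(2) by auto
  then show ?thesis using Q_form_eq[of 1 k] by (simp add: Q1_def)
qed

lemma Q1_pos: "Q1 k > 0"
  unfolding Q1_def
proof (rule powr_sum_pos_at_1[where s = nd and \<gamma> = \<gamma>])
  show "inj_on nd {..k}" using inj_nd by (rule inj_on_subset) simp
  show "((\<lambda>x. (\<Sum>i\<le>k. dual_coeff k i * x powr nd i) * (1 - x) powr \<gamma> * poly P x) has_integral coeff P k) {0..1}"
    if "degree P \<le> k" for P
    using has_integral_form_pairing[where k = k and v = "dual_coeff k" and P = P] unfolding form_pairing_dual[OF that] .
qed

text \<open>The coefficient vectors \<open>w\<close> of \<open>x Q\<^sub>k\<close> and \<open>z\<close> of \<open>\<Sum>\<^sub>l J\<^sub>l\<^sub>k Q\<^sub>l\<close> agree, because they have the same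
  pairings with the polynomials \<open>B\<^sub>j\<close>.\<close>

lemma Q1_eigenvector: "(\<Sum>l\<le>k + 2. J l k * Q1 l) = Q1 k"
proof -
  \<comment> \<open>Multiplication by \<open>x\<close> raises each exponent by 1, hence each node
    index by 2, so the product lives on indices below \<open>k + 3\<close>. Column \<open>k\<close>
    of \<open>J\<close> likewise ends at row \<open>k + 2\<close>.\<close>
  define K where "K = Suc (Suc (Suc k))"
  define w where "w i = (if i < 2 then 0 else dual_coeff k (i - 2))" for i
  define z where "z i = (\<Sum>l<K. J l k * dual_coeff l i)" for i
  have shift: "(\<Sum>i<K. w i * f i) = (\<Sum>i\<le>k. dual_coeff k i * f (Suc (Suc i)))" for f
    unfolding K_def sum.lessThan_Suc_shift[of _ "Suc (Suc k)"] sum.lessThan_Suc_shift[of _ "Suc k"]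
    by (simp add: w_def lessThan_Suc_atMost)
  have extend: "(\<Sum>i<K. dual_coeff l i * f i) = (\<Sum>i\<le>l. dual_coeff l i * f i)" if "l < K" for l f
    using that by (intro sum.mono_neutral_right) (auto simp: dual_coeff_eq_0)
  have delta: "form_pairing k (dual_coeff k) (B l) = (if l = k then 1 else 0)" for l
    using dual_coeff_pairing[of k l] by (simp add: form_pairing_def pairing_def)
  have "w i = z i" if "i < K" for i
  proof (rule upper_triangular_unique[OF _ _ _ that])
    fix j assume j: "j < K"
    \<comment> \<open>The factor \<open>x\<close> is moved from the form onto \<open>B j\<close>,
      where the recurrence applies.\<close>
    have "(\<Sum>i<K. w i * pairing j i) = form_pairing k (dual_coeff k) (pCons 0 (B j))"
      unfolding shift by (simp add: pairing_def form_pairing_def moment_pairing_pCons)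
    also have "\<dots> = (\<Sum>l\<le>Suc j. J j l * form_pairing k (dual_coeff k) (B l))"
      unfolding x_times_B form_pairing_def moment_pairing_sum moment_pairing_smult sum_distrib_left
      by (subst sum.swap) (simp add: mult_ac)
    also have "\<dots> = J j k"
      unfolding delta by (cases "k \<le> Suc j") (auto simp: J_eq_0 if_distrib cong: if_cong)
    finally have w: "(\<Sum>i<K. w i * pairing j i) = J j k" .
    have "(\<Sum>i<K. z i * pairing j i) = (\<Sum>l<K. J l k * (\<Sum>i<K. dual_coeff l i * pairing j i))"
      unfolding z_def sum_distrib_left sum_distrib_right by (subst sum.swap) (simp add: mult_ac)
    also have "\<dots> = (\<Sum>l<K. J l k * (if j = l then 1 else 0))"
      by (intro sum.cong refl) (simp add: extend dual_coeff_pairing)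
    also have "\<dots> = J j k" using j by (simp add: if_distrib cong: if_cong)
    finally show "(\<Sum>i<K. w i * pairing j i) = (\<Sum>i<K. z i * pairing j i)" using w by simp
  qed (use pairing_diag pairing_eq_0 in auto)
  \<comment> \<open>Equal coefficient vectors have equal sums, which are the values at 1; the factor
    1 is the constant function to which \<open>shift\<close> and \<open>extend\<close> are
    applied.\<close>
  then have "(\<Sum>i<K. w i * 1) = (\<Sum>i<K. z i * 1)" by (intro sum.cong) auto
  moreover have "(\<Sum>i<K. w i * 1) = Q1 k" unfolding shift by (simp add: Q1_def)
  moreover have "(\<Sum>i<K. z i * 1) = (\<Sum>l<K. J l k * Q1 l)"
  proof -
    have "(\<Sum>i<K. z i * 1) = (\<Sum>l<K. J l k * (\<Sum>i<K. dual_coeff l i * 1))"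
      unfolding z_def sum_distrib_left by (simp, subst sum.swap) simp
    also have "\<dots> = (\<Sum>l<K. J l k * Q1 l)"
      by (intro sum.cong refl) (subst extend, auto simp: Q1_def)
    finally show ?thesis .
  qed
  moreover have "{..<K} = {..k + 2}" by (auto simp: K_def)
  ultimately show ?thesis by simp
qed

text \<open>Conjugating the transpose of \<open>J\<close> by its positive eigenvector
  \<open>Q1\<close> of eigenvalue 1 makes every row sum 1; signs and band structure are inherited
  from \<open>J\<close>.\<close>

lemma multiple_stochastic:
  assumes P: "\<And>k l. P k l = Q1 l / Q1 k * J l k"
  shows "multiple_stochastic_typeI P"
  unfolding multiple_stochastic_typeI_def
proof (intro conjI allI impI)
  show "0 \<le> P k l" for k l
    unfolding P using Q1_pos[of k] Q1_pos[of l] J_nonneg by (intro mult_nonneg_nonneg) auto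
  show zero: "P k l = 0" if "\<not> (k \<le> l + 1 \<and> l \<le> k + 2)" for k l
    unfolding P using J_eq_0[of l k] that by auto
  fix k
  have "(\<Sum>l\<le>k + 2. P k l) = (\<Sum>l\<le>k + 2. J l k * Q1 l) / Q1 k"
    unfolding P sum_divide_distrib by (simp add: mult.commute)
  also have "\<dots> = 1" using Q1_eigenvector[of k] Q1_pos[of k] by simp
  finally have "(\<Sum>l\<le>k + 2. P k l) = 1" .
  moreover have "P k sums (\<Sum>l\<le>k + 2. P k l)"
    by (rule sums_finite) (use zero[of k] in auto)
  ultimately show "P k sums 1" by (simp only:)
qed

end

theorem theorem12:
  fixes \<alpha> \<beta> \<gamma> :: real and P :: "nat \<Rightarrow> nat \<Rightarrow> real"
  assumes "\<alpha> > -1" and "\<beta> > -1" and "\<gamma> > -1" and "\<alpha> \<noteq> \<beta>" and "\<bar>\<alpha> - \<beta>\<bar> < 1"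
    and "\<And>k l. \<not> (k \<le> l + 1 \<and> l \<le> k + 2) \<Longrightarrow> P k l = 0"
    and "\<And>n. P (2*n) (2*n+2) =
           Q_form \<alpha> \<beta> \<gamma> (n+2) (n+1) 1 / Q_form \<alpha> \<beta> \<gamma> (n+1) n 1 * coef_d \<alpha> \<beta> \<gamma> (n+1) (n+1)"
    and "\<And>n. P (2*n+1) (2*n+3) =
           Q_form \<alpha> \<beta> \<gamma> (n+2) (n+2) 1 / Q_form \<alpha> \<beta> \<gamma> (n+1) (n+1) 1 * coef_d \<alpha> \<beta> \<gamma> (n+2) (n+1)"
    and "\<And>n. P (2*n) (2*n+1) =
           Q_form \<alpha> \<beta> \<gamma> (n+1) (n+1) 1 / Q_form \<alpha> \<beta> \<gamma> (n+1) n 1 * coef_c \<alpha> \<beta> \<gamma> (n+1) n"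
    and "\<And>n. P (2*n+1) (2*n+2) =
           Q_form \<alpha> \<beta> \<gamma> (n+2) (n+1) 1 / Q_form \<alpha> \<beta> \<gamma> (n+1) (n+1) 1 * coef_c \<alpha> \<beta> \<gamma> (n+1) (n+1)"
    and "\<And>n. P (2*n) (2*n) = coef_b \<alpha> \<beta> \<gamma> n n"
    and "\<And>n. P (2*n+1) (2*n+1) = coef_b \<alpha> \<beta> \<gamma> (n+1) n"
    and "\<And>n. P (2*n+2) (2*n+1) =
           Q_form \<alpha> \<beta> \<gamma> (n+1) (n+1) 1 / Q_form \<alpha> \<beta> \<gamma> (n+2) (n+1) 1"
    and "\<And>n. P (2*n+1) (2*n) =
           Q_form \<alpha> \<beta> \<gamma> (n+1) n 1 / Q_form \<alpha> \<beta> \<gamma> (n+1) (n+1) 1"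
  shows "multiple_stochastic_typeI P"
proof -
  interpret jacobi_pineiro \<alpha> \<beta> \<gamma> by unfold_locales (use assms(1-5) in auto)
  obtain B b c d \<kappa> where sys:
    "\<And>N. degree (B N) = N \<and> lead_coeff (B N) = 1"
    "\<And>N. pCons 0 (B N) = B (Suc N) + smult (b N) (B N) + smult (c N) (B (N - 1)) + smult (d N) (B (N - 2))"
    "\<And>N. b N \<ge> 0" "\<And>N. c N \<ge> 0" "\<And>N. d N \<ge> 0"
    "\<And>N. \<kappa> N > 0"
    "\<And>N s. s > -1 \<Longrightarrow> moment_pairing (B N) s = \<kappa> N * moment s * node_prod \<alpha> \<beta> N s / pochhammer (s + \<gamma> + 2) N"
    by (rule step_line_polynomials) metis
  interpret step_line_system \<alpha> \<beta> \<gamma> B b c d \<kappa>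
    by unfold_locales (fact sys)+
  \<comment> \<open>The form with index \<open>k\<close> has a multi-index of total size
    \<open>k + 1\<close>.\<close>
  have Q: "Q_form \<alpha> \<beta> \<gamma> (n+1) n 1 = Q1 (2*n)" "Q_form \<alpha> \<beta> \<gamma> (n+1) (n+1) 1 = Q1 (2*n+1)"
    "Q_form \<alpha> \<beta> \<gamma> (n+2) (n+1) 1 = Q1 (2*n+2)" "Q_form \<alpha> \<beta> \<gamma> (n+2) (n+2) 1 = Q1 (2*n+3)" for n
    by (rule Q_form_at_1; simp)+
  have up: "P k (k + 2) = Q1 (k + 2) / Q1 k * J (k + 2) k" for k
  proof (cases "even k")
    case True
    then obtain n where k: "k = 2 * n" by (rule evenE)
    show ?thesis using assms(7)[of n] unfolding k Q coef_d_def jacobi_matrix_eq by (simp add: numeral_eq_Suc)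
  next
    case False
    then obtain n where k: "k = 2 * n + 1" by (rule oddE)
    show ?thesis using assms(8)[of n] unfolding k Q coef_d_def jacobi_matrix_eq by (simp add: numeral_eq_Suc)
  qed
  have up1: "P k (k + 1) = Q1 (k + 1) / Q1 k * J (k + 1) k" for k
  proof (cases "even k")
    case True
    then obtain n where k: "k = 2 * n" by (rule evenE)
    show ?thesis using assms(9)[of n] unfolding k Q coef_c_def jacobi_matrix_eq by (simp add: numeral_eq_Suc)
  next
    case False
    then obtain n where k: "k = 2 * n + 1" by (rule oddE)
    show ?thesis using assms(10)[of n] unfolding k Q coef_c_def jacobi_matrix_eq by (simp add: numeral_eq_Suc)
  qed
  \<comment> \<open>The factor \<open>Q1 k / Q1 k\<close> is 1 and brings the diagonal into the
    common shape \<open>Q1 l / Q1 k * J l k\<close>.\<close>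
  have diag: "P k k = Q1 k / Q1 k * J k k" for k
  proof (cases "even k")
    case True
    then obtain n where k: "k = 2 * n" by (rule evenE)
    show ?thesis using assms(11)[of n] Q1_pos[of k] unfolding k coef_b_def jacobi_matrix_eq by (simp add: mult_2)
  next
    case False
    then obtain n where k: "k = 2 * n + 1" by (rule oddE)
    show ?thesis using assms(12)[of n] Q1_pos[of k] unfolding k coef_b_def jacobi_matrix_eq by (simp add: mult_2)
  qed
  \<comment> \<open>The entry \<open>J l (Suc l)\<close> is 1, so the prescribed quotient already
    has the common shape.\<close>
  have down: "P (Suc l) l = Q1 l / Q1 (Suc l) * J l (Suc l)" for l
  proof (cases "even l")
    case True
    then obtain n where l: "l = 2 * n" by (rule evenE)
    show ?thesis using assms(14)[of n] unfolding l Q by simp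
  next
    case False
    then obtain n where l: "l = 2 * n + 1" by (rule oddE)
    show ?thesis using assms(13)[of n] unfolding l Q by simp
  qed
  show ?thesis
  proof (rule multiple_stochastic)
    fix k l
    consider "l = k + 2" | "l = k + 1" | "l = k" | "k = Suc l" | "\<not> (k \<le> l + 1 \<and> l \<le> k + 2)" by linarith
    then show "P k l = Q1 l / Q1 k * J l k"
    proof cases
      case 5
      then show ?thesis using assms(6)[OF 5] J_eq_0[of l k] by auto
    qed (use up up1 diag down in auto)
  qed
qed

end
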